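(* Let $\mathcal{E}(\cdot\mid\mathcal{F}_t):L^2(\mathcal{F}_T;\mathbb{R}^K)\to L^2(\mathcal{F}_t;\mathbb{R}^K)$, $0\le t\le T$, be a family of operators and let $\{\mathcal{Q}_t\subset L^2(\mathcal{F}_T;\mathbb{R}^K)\}_{0\le t\le T}$ be such that $Q\in\mathcal{Q}_t$ implies $Q+q\in\mathcal{Q}_t$ for all $q\in L^\infty(\mathcal{F}_t;\mathbb{R}^K)$, and such that $\mathcal{E}$ is dynamically monotone for $\{\mathcal{Q}_t\}$. Then the following two statements are equivalent. 1. $\mathcal{E}(\cdot\mid\mathcal{F}_t)$ is an $\mathcal{F}_t$-consistent, dynamically translation invariant, nonlinear expectation for $\{\mathcal{Q}_t\}$. 2. There exists a driver $F$ which is balanced on $\{\mathcal{Q}_t\}$, is independent of $Y$, and satisfies the normalisation condition $F(\omega,t,Y_t,0)=0$, such that, for all $Q\in L^2(\mathcal{F}_T;\mathbb{R}^K)$, $Y_t=\mathcal{E}(Q\mid\mathcal{F}_t)$ is the solution to the BSDE with terminal condition $Q$ and driver $F$. Furthermore, these two statements are related by the equation $$F(\omega,t,Y_t,Z_t)=\mathcal{E}(Z_tM_{t+1}\mid\mathcal{F}_t)\qquad (0\le t<T).$$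
   Context: Setting. $N,K\ge 1$ are integers and $T\geq 1$ is a deterministic integer. $X=(X_t)_{0\le t\le T}$ is a process on a probability space $(\Omega,\mathcal{F},\mathbb{P})$ with values in the standard basis (column) vectors $\{e_1,\dots,e_N\}$ of $\mathbb{R}^N$, and $\mathcal{F}_t$ is the completion of the $\sigma$-algebra generated by $X_0,\dots,X_t$. Put $M_t:=X_t-E[X_t\mid\mathcal{F}_{t-1}]$ for $1\le t\le T$. Since $X$ has finitely many paths, $L^1(\mathcal{F}_t)=L^2(\mathcal{F}_t)=L^\infty(\mathcal{F}_t)$. The superscript $*$ denotes transposition, $e_i^*v$ is the $i$th component (row) of a vector (matrix) $v$; inequalities between vectors are componentwise. $I_A$ is the indicator of $A$. All adapted processes $Y$ ($\mathbb{R}^K$-valued) and $Z$ ($\mathbb{R}^{K\times N}$-valued) have $Y_t,Z_t\in L^\infty(\mathcal{F}_t)$. $\mathbb{J}_t:=\{j:\mathbb{P}(X_{t+1}=e_j\mid\mathcal{F}_t)>0\}$. Equivalences. For $\mathcal{F}_t$-measurable $Z^1_t,Z^2_t$ (matrices or rows), $Z^1_t\sim_{M_{t+1}}Z^2_t$ means $Z^1_tM_{t+1}=Z^2_tM_{t+1}$ $\mathbb{P}$-a.s.; for adapted processes, $Z^1\sim_MZ^2$ means this for all $t\in\{0,\dots,T-1\}$. Driver. A driver is an adapted map $F:\Omega\times\{0,\dots,T\}\times\mathbb{R}^K\times\mathbb{R}^{K\times N}\to\mathbb{R}^K$ with $F(\omega,t,Y_t,Z_t)\in L^\infty(\mathcal{F}_t)$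 for all $t$ and all $Y_t,Z_t\in L^\infty(\mathcal{F}_t)$. A driver is called regular here if (a) for any adapted $Y$, $Z^1\sim_MZ^2$ implies $F(\omega,t,Y_t,Z^1_t)=F(\omega,t,Y_t,Z^2_t)$ $\mathbb{P}$-a.s. for all $t\in\{0,\dots,T-1\}$; and (b) for any adapted $Z$ and all $t\in\{0,\dots,T-1\}$, the map $Y_t\mapsto Y_t-F(\omega,t,Y_t,Z_t)$ is $\mathbb{P}$-a.s. a bijection of $\mathbb{R}^K$, up to equality $\mathbb{P}$-a.s. (i.e. a bijection of the set of $\mathbb{R}^K$-valued $\mathcal{F}_t$-measurable random variables, identified when a.s. equal, onto itself). BSDE. For a driver $F$ and $Q\in L^\infty(\mathcal{F}_T;\mathbb{R}^K)$, a solution of the BSDE is a pair of adapted processes $(Y,Z)$ with $Y_t-\sum_{t\le u<T}F(\omega,u,Y_u,Z_u)+\sum_{t\le u<T}Z_uM_{u+1}=Q$ $\mathbb{P}$-a.s. for all $t\in\{0,\dots,T\}$. For regular $F$ a solution exists and is unique up to indistinguishability of $Y$ and $\sim_M$ for $Z$; "$Y$ is the solution" means $Y$ is the first component of it. Nonlinear expectation. A system of operators $\mathcal{E}(\cdot\mid\mathcal{F}_t):L^2(\mathcal{F}_T)\to L^2(\mathcal{F}_t)$, $0\le t\le T$, is an $\mathcal{F}_t$-consistent nonlinear expectation for $\{\mathcal{Q}_t\}$ if: 1. for $Q,Q'\in\mathcal{Q}_t$, if $Q\ge Q'$ $\mathbb{P}$-a.s. componentwise then $\mathcal{E}(Q\mid\mathcal{F}_t)\ge\mathcal{E}(Q'\mid\mathcal{F}_t)$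 $\mathbb{P}$-a.s. componentwise, with, for each $i$, $e_i^*\mathcal{E}(Q\mid\mathcal{F}_t)=e_i^*\mathcal{E}(Q'\mid\mathcal{F}_t)$ ($\mathbb{P}$-a.s.) only if $e_i^*Q=e_i^*Q'$ $\mathbb{P}$-a.s.; 2. $\mathcal{E}(Q\mid\mathcal{F}_t)=Q$ $\mathbb{P}$-a.s. for any $\mathcal{F}_t$-measurable $Q$; 3. $\mathcal{E}(\mathcal{E}(Q\mid\mathcal{F}_t)\mid\mathcal{F}_s)=\mathcal{E}(Q\mid\mathcal{F}_s)$ $\mathbb{P}$-a.s. for any $s\le t$; 4. for any $A\in\mathcal{F}_t$, $I_A\mathcal{E}(Q\mid\mathcal{F}_t)=\mathcal{E}(I_AQ\mid\mathcal{F}_t)$ $\mathbb{P}$-a.s. Dynamic monotonicity. $\mathcal{E}$ is dynamically monotone for $\{\mathcal{Q}_t\}$ if for all $s\le t$: (i) $\mathcal{E}$ is an $\mathcal{F}_t$-consistent nonlinear expectation for $\{\mathcal{Q}_t\}$; (ii) $\mathcal{Q}_s\subseteq\mathcal{Q}_t$ ($\{\mathcal{Q}_t\}$ is nondecreasing); (iii) $\mathcal{E}(Q\mid\mathcal{F}_t)\in\mathcal{Q}_s$ for all $Q\in\mathcal{Q}_s$. Translation invariance. $\mathcal{E}$ is (dynamically) translation invariant if $\mathcal{E}(Q+q\mid\mathcal{F}_t)=\mathcal{E}(Q\mid\mathcal{F}_t)+q$ for all $t$, all $Q\in L^2(\mathcal{F}_T)$ and $q\in L^2(\mathcal{F}_t)$.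 Balanced driver. For a nondecreasing family $\{\mathcal{Q}_t\subset L^2(\mathcal{F}_T)\}$, a regular driver $F$ is balanced on $\{\mathcal{Q}_t\}$ if for each $t\in\{0,\dots,T-1\}$ and any $Q^1,Q^2\in\mathcal{Q}_t$, the corresponding BSDE solutions $(Y^1,Z^1),(Y^2,Z^2)$ (driver $F$, terminal values $Q^1,Q^2$) satisfy: $\mathbb{P}$-a.s., for all $i$, $$e_i^*F(\omega,t,Y^2_t,Z^1_t)-e_i^*F(\omega,t,Y^2_t,Z^2_t)\ge\min_{j\in\mathbb{J}_t}\{e_i^*(Z^1_t-Z^2_t)(e_j-E[X_{t+1}\mid\mathcal{F}_t])\},$$ with equality ($\mathbb{P}$-a.s.) only if $e_i^*Z^1_t\sim_{M_{t+1}}e_i^*Z^2_t$; and, $\mathbb{P}$-a.s., if $Y^1_t-F(\omega,t,Y^1_t,Z^1_t)\ge Y^2_t-F(\omega,t,Y^2_t,Z^1_t)$ then $Y^1_t\ge Y^2_t$. "Independent of $Y$", the normalisation condition, and the final equation concern times $t\in\{0,\dots,T-1\}$ and all $Y_t,Z_t\in L^\infty(\mathcal{F}_t)$, up to $\mathbb{P}$-a.s. equality. *)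

theory Defs
  imports "HOL-Probability.Probability"
begin

text \<open>
  Conventions. \<open>\<real>\<^sup>K\<close>, \<open>\<real>\<^sup>N\<close> and \<open>\<real>\<^sup>K\<^sup>\<times>\<^sup>N\<close> are \<open>real^'k\<close>, \<open>real^'n\<close> and \<open>real^'n^'k\<close>; the basis vector \<open>e\<^sub>j\<close> is
  \<open>axis j 1\<close>, row \<open>i\<close> of a matrix \<open>z\<close> is \<open>z $ i\<close>, and \<open>\<le>\<close> on \<open>real^'k\<close> is the library's
  componentwise order.  The measure \<open>P\<close> is the underlying probability measure, \<open>X\<close> the state
  process, \<open>T\<close> the horizon.
  Elements of the L-spaces are represented by functions; every statement about them is made up
  to \<open>P\<close>-a.s. equality.
\<close>

text \<open>
  The generated sigma-algebra is completed with respect to the restriction of \<open>P\<close> to it.  The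
  resulting sets need not be \<open>P\<close>-measurable unless \<open>P\<close> is complete, which is not assumed, so
  integrals and conditional expectations are taken with respect to \<open>completion P\<close>.
\<close>
definition filt :: "'w measure \<Rightarrow> (nat \<Rightarrow> 'w \<Rightarrow> real^'n) \<Rightarrow> nat \<Rightarrow> 'w measure" where
  "filt P X t = completion (restr_to_subalg P
     (sigma (space P) {X s -` B \<inter> space P | s B. s \<le> t \<and> B \<in> sets borel}))"

definition L2 ::
  "'w measure \<Rightarrow> (nat \<Rightarrow> 'w \<Rightarrow> real^'n) \<Rightarrow> nat \<Rightarrow> ('w \<Rightarrow> 'b::euclidean_space) set" where
  "L2 P X t = {f. f \<in> borel_measurable (filt P X t) \<and>
                  integrable (completion P) (\<lambda>\<omega>. (norm (f \<omega>))\<^sup>2)}"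

definition Linf ::
  "'w measure \<Rightarrow> (nat \<Rightarrow> 'w \<Rightarrow> real^'n) \<Rightarrow> nat \<Rightarrow> ('w \<Rightarrow> 'b::euclidean_space) set" where
  "Linf P X t = {f. f \<in> borel_measurable (filt P X t) \<and> (\<exists>C. AE \<omega> in P. norm (f \<omega>) \<le> C)}"

definition adapted ::
  "'w measure \<Rightarrow> (nat \<Rightarrow> 'w \<Rightarrow> real^'n) \<Rightarrow> nat \<Rightarrow> (nat \<Rightarrow> 'w \<Rightarrow> 'b::euclidean_space) \<Rightarrow> bool" where
  "adapted P X T Y \<longleftrightarrow> (\<forall>t\<le>T. Y t \<in> Linf P X t)"

definition cond_mean ::
  "'w measure \<Rightarrow> (nat \<Rightarrow> 'w \<Rightarrow> real^'n) \<Rightarrow> nat \<Rightarrow> ('w \<Rightarrow> real^'m) \<Rightarrow> 'w \<Rightarrow> real^'m" where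
  "cond_mean P X t f \<omega> =
     (\<chi> i. real_cond_exp (completion P) (filt P X t) (\<lambda>\<omega>'. f \<omega>' $ i) \<omega>)"

text \<open>The martingale difference \<open>M\<^sub>t\<close>; only meaningful for \<open>1 \<le> t\<close>.\<close>
definition mart_diff ::
  "'w measure \<Rightarrow> (nat \<Rightarrow> 'w \<Rightarrow> real^'n) \<Rightarrow> nat \<Rightarrow> 'w \<Rightarrow> real^'n" where
  "mart_diff P X t \<omega> = X t \<omega> - cond_mean P X (t - 1) (X t) \<omega>"

definition possible_jumps ::
  "'w measure \<Rightarrow> (nat \<Rightarrow> 'w \<Rightarrow> real^'n) \<Rightarrow> nat \<Rightarrow> 'w \<Rightarrow> 'n set" where
  "possible_jumps P X t \<omega> =
     {j. real_cond_exp (completion P) (filt P X t)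
           (indicator {\<omega>' \<in> space P. X (t + 1) \<omega>' = axis j 1}) \<omega> > 0}"

text \<open>The relation \<open>\<sim>\<close> with respect to \<open>M\<^sub>t\<^sub>+\<^sub>1\<close>, for matrices, for rows, and for processes.\<close>

definition sim_at ::
  "'w measure \<Rightarrow> (nat \<Rightarrow> 'w \<Rightarrow> real^'n) \<Rightarrow> nat \<Rightarrow>
   ('w \<Rightarrow> real^'n^'k) \<Rightarrow> ('w \<Rightarrow> real^'n^'k) \<Rightarrow> bool" where
  "sim_at P X t Z1 Z2 \<longleftrightarrow>
     (AE \<omega> in P. Z1 \<omega> *v mart_diff P X (t + 1) \<omega> = Z2 \<omega> *v mart_diff P X (t + 1) \<omega>)"

definition sim_row_at ::
  "'w measure \<Rightarrow> (nat \<Rightarrow> 'w \<Rightarrow> real^'n) \<Rightarrow> nat \<Rightarrow> ('w \<Rightarrow> real^'n) \<Rightarrow> ('w \<Rightarrow> real^'n) \<Rightarrow> bool" where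
  "sim_row_at P X t z1 z2 \<longleftrightarrow>
     (AE \<omega> in P. z1 \<omega> \<bullet> mart_diff P X (t + 1) \<omega> = z2 \<omega> \<bullet> mart_diff P X (t + 1) \<omega>)"

definition sim_process ::
  "'w measure \<Rightarrow> (nat \<Rightarrow> 'w \<Rightarrow> real^'n) \<Rightarrow> nat \<Rightarrow>
   (nat \<Rightarrow> 'w \<Rightarrow> real^'n^'k) \<Rightarrow> (nat \<Rightarrow> 'w \<Rightarrow> real^'n^'k) \<Rightarrow> bool" where
  "sim_process P X T Z1 Z2 \<longleftrightarrow> (\<forall>t<T. sim_at P X t (Z1 t) (Z2 t))"


section \<open>Drivers and BSDEs\<close>

type_synonym ('w, 'k, 'n) driver_fun = "'w \<Rightarrow> nat \<Rightarrow> real^'k \<Rightarrow> real^'n^'k \<Rightarrow> real^'k"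

definition driver ::
  "'w measure \<Rightarrow> (nat \<Rightarrow> 'w \<Rightarrow> real^'n) \<Rightarrow> nat \<Rightarrow> ('w, 'k::finite, 'n::finite) driver_fun \<Rightarrow> bool" where
  "driver P X T F \<longleftrightarrow>
     (\<forall>t\<le>T. \<forall>y z. (\<lambda>\<omega>. F \<omega> t y z) \<in> borel_measurable (filt P X t)) \<and>
     (\<forall>t\<le>T. \<forall>Y\<in>Linf P X t. \<forall>Z\<in>Linf P X t. (\<lambda>\<omega>. F \<omega> t (Y \<omega>) (Z \<omega>)) \<in> Linf P X t)"

text \<open>
  The last two conjuncts say that \<open>Y \<mapsto> Y - F(\<omega>,t,Y,Z\<^sub>t)\<close> is onto and one-to-one on a.s.-classes of
  \<open>\<F>\<^sub>t\<close>-measurable random variables.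
\<close>
definition regular_driver ::
  "'w measure \<Rightarrow> (nat \<Rightarrow> 'w \<Rightarrow> real^'n) \<Rightarrow> nat \<Rightarrow> ('w, 'k::finite, 'n::finite) driver_fun \<Rightarrow> bool" where
  "regular_driver P X T F \<longleftrightarrow>
     driver P X T F \<and>
     (\<forall>Y Z1 Z2. adapted P X T Y \<longrightarrow> adapted P X T Z1 \<longrightarrow> adapted P X T Z2 \<longrightarrow>
        sim_process P X T Z1 Z2 \<longrightarrow>
        (\<forall>t<T. AE \<omega> in P. F \<omega> t (Y t \<omega>) (Z1 t \<omega>) = F \<omega> t (Y t \<omega>) (Z2 t \<omega>))) \<and>
     (\<forall>Z. adapted P X T Z \<longrightarrow> (\<forall>t<T.
        (\<forall>W \<in> borel_measurable (filt P X t). \<exists>Y \<in> borel_measurable (filt P X t).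
           AE \<omega> in P. Y \<omega> - F \<omega> t (Y \<omega>) (Z t \<omega>) = W \<omega>) \<and>
        (\<forall>Y \<in> borel_measurable (filt P X t). \<forall>Y' \<in> borel_measurable (filt P X t).
           (AE \<omega> in P. Y \<omega> - F \<omega> t (Y \<omega>) (Z t \<omega>) = Y' \<omega> - F \<omega> t (Y' \<omega>) (Z t \<omega>)) \<longrightarrow>
           (AE \<omega> in P. Y \<omega> = Y' \<omega>))))"

definition bsde_solution ::
  "'w measure \<Rightarrow> (nat \<Rightarrow> 'w \<Rightarrow> real^'n) \<Rightarrow> nat \<Rightarrow> ('w, 'k::finite, 'n::finite) driver_fun \<Rightarrow> ('w \<Rightarrow> real^'k) \<Rightarrow>
   (nat \<Rightarrow> 'w \<Rightarrow> real^'k) \<Rightarrow> (nat \<Rightarrow> 'w \<Rightarrow> real^'n^'k) \<Rightarrow> bool" where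
  "bsde_solution P X T F Q Y Z \<longleftrightarrow>
     adapted P X T Y \<and> adapted P X T Z \<and>
     (\<forall>t\<le>T. AE \<omega> in P.
        Y t \<omega> - (\<Sum>u = t..<T. F \<omega> u (Y u \<omega>) (Z u \<omega>))
              + (\<Sum>u = t..<T. Z u \<omega> *v mart_diff P X (u + 1) \<omega>) = Q \<omega>)"

definition balanced_driver ::
  "'w measure \<Rightarrow> (nat \<Rightarrow> 'w \<Rightarrow> real^'n) \<Rightarrow> nat \<Rightarrow> (nat \<Rightarrow> ('w \<Rightarrow> real^'k) set) \<Rightarrow>
   ('w, 'k::finite, 'n::finite) driver_fun \<Rightarrow> bool" where
  "balanced_driver P X T \<Q> F \<longleftrightarrow>
     regular_driver P X T F \<and>
     (\<forall>t<T. \<forall>Q1\<in>\<Q> t. \<forall>Q2\<in>\<Q> t. \<forall>Y1 Z1 Y2 Z2.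
        bsde_solution P X T F Q1 Y1 Z1 \<longrightarrow> bsde_solution P X T F Q2 Y2 Z2 \<longrightarrow>
        (let lhs = (\<lambda>i \<omega>. F \<omega> t (Y2 t \<omega>) (Z1 t \<omega>) $ i - F \<omega> t (Y2 t \<omega>) (Z2 t \<omega>) $ i);
             rhs = (\<lambda>i \<omega>. Min ((\<lambda>j. ((Z1 t \<omega> - Z2 t \<omega>) *v
                                (axis j 1 - cond_mean P X t (X (t + 1)) \<omega>)) $ i)
                             ` possible_jumps P X t \<omega>))
         in (AE \<omega> in P. \<forall>i. lhs i \<omega> \<ge> rhs i \<omega>) \<and>
            (\<forall>i. (AE \<omega> in P. lhs i \<omega> = rhs i \<omega>) \<longrightarrow>
               sim_row_at P X t (\<lambda>\<omega>. Z1 t \<omega> $ i) (\<lambda>\<omega>. Z2 t \<omega> $ i))) \<and>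
        (AE \<omega> in P. Y1 t \<omega> - F \<omega> t (Y1 t \<omega>) (Z1 t \<omega>) \<ge> Y2 t \<omega> - F \<omega> t (Y2 t \<omega>) (Z1 t \<omega>) \<longrightarrow>
           Y1 t \<omega> \<ge> Y2 t \<omega>))"

definition independent_of_Y ::
  "'w measure \<Rightarrow> (nat \<Rightarrow> 'w \<Rightarrow> real^'n) \<Rightarrow> nat \<Rightarrow> ('w, 'k::finite, 'n::finite) driver_fun \<Rightarrow> bool" where
  "independent_of_Y P X T F \<longleftrightarrow>
     (\<forall>t<T. \<forall>Y\<in>Linf P X t. \<forall>Y'\<in>Linf P X t. \<forall>Z\<in>Linf P X t.
        AE \<omega> in P. F \<omega> t (Y \<omega>) (Z \<omega>) = F \<omega> t (Y' \<omega>) (Z \<omega>))"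

definition normalised_driver ::
  "'w measure \<Rightarrow> (nat \<Rightarrow> 'w \<Rightarrow> real^'n) \<Rightarrow> nat \<Rightarrow> ('w, 'k::finite, 'n::finite) driver_fun \<Rightarrow> bool" where
  "normalised_driver P X T F \<longleftrightarrow>
     (\<forall>t<T. \<forall>Y\<in>Linf P X t. AE \<omega> in P. F \<omega> t (Y \<omega>) 0 = 0)"


section \<open>Nonlinear expectations\<close>

text \<open>
  A family of maps \<open>L\<^sup>2(\<F>\<^sub>T) \<rightarrow> L\<^sup>2(\<F>\<^sub>t)\<close>: \<open>\<E> t Q\<close> is a version of \<open>\<E>(Q | \<F>\<^sub>t)\<close>.  The second conjunct makes
  the map well defined on a.s.-classes.
\<close>
definition operator_family ::
  "'w measure \<Rightarrow> (nat \<Rightarrow> 'w \<Rightarrow> real^'n) \<Rightarrow> nat \<Rightarrow>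
   (nat \<Rightarrow> ('w \<Rightarrow> real^'k) \<Rightarrow> ('w \<Rightarrow> real^'k)) \<Rightarrow> bool" where
  "operator_family P X T \<E> \<longleftrightarrow>
     (\<forall>t\<le>T. \<forall>Q\<in>L2 P X T. \<E> t Q \<in> L2 P X t) \<and>
     (\<forall>t\<le>T. \<forall>Q\<in>L2 P X T. \<forall>Q'\<in>L2 P X T.
        (AE \<omega> in P. Q \<omega> = Q' \<omega>) \<longrightarrow> (AE \<omega> in P. \<E> t Q \<omega> = \<E> t Q' \<omega>))"

text \<open>A family of sets of a.s.-classes in \<open>L\<^sup>2(\<F>\<^sub>T)\<close>, as sets of representatives closed under a.s. equality.\<close>
definition L2_subset_family ::
  "'w measure \<Rightarrow> (nat \<Rightarrow> 'w \<Rightarrow> real^'n) \<Rightarrow> nat \<Rightarrow> (nat \<Rightarrow> ('w \<Rightarrow> real^'k) set) \<Rightarrow> bool" where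
  "L2_subset_family P X T \<Q> \<longleftrightarrow>
     (\<forall>t\<le>T. \<Q> t \<subseteq> L2 P X T) \<and>
     (\<forall>t\<le>T. \<forall>Q\<in>\<Q> t. \<forall>Q'\<in>L2 P X T. (AE \<omega> in P. Q \<omega> = Q' \<omega>) \<longrightarrow> Q' \<in> \<Q> t)"

definition consistent_nonlinear_expectation ::
  "'w measure \<Rightarrow> (nat \<Rightarrow> 'w \<Rightarrow> real^'n) \<Rightarrow> nat \<Rightarrow> (nat \<Rightarrow> ('w \<Rightarrow> real^'k) set) \<Rightarrow>
   (nat \<Rightarrow> ('w \<Rightarrow> real^'k) \<Rightarrow> ('w \<Rightarrow> real^'k)) \<Rightarrow> bool" where
  "consistent_nonlinear_expectation P X T \<Q> \<E> \<longleftrightarrow>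
     operator_family P X T \<E> \<and>
     (\<forall>t\<le>T. \<forall>Q\<in>\<Q> t. \<forall>Q'\<in>\<Q> t. (AE \<omega> in P. Q \<omega> \<ge> Q' \<omega>) \<longrightarrow>
        (AE \<omega> in P. \<E> t Q \<omega> \<ge> \<E> t Q' \<omega>) \<and>
        (\<forall>i. (AE \<omega> in P. \<E> t Q \<omega> $ i = \<E> t Q' \<omega> $ i) \<longrightarrow> (AE \<omega> in P. Q \<omega> $ i = Q' \<omega> $ i))) \<and>
     (\<forall>t\<le>T. \<forall>Q\<in>L2 P X t. AE \<omega> in P. \<E> t Q \<omega> = Q \<omega>) \<and>
     (\<forall>t\<le>T. \<forall>s\<le>t. \<forall>Q\<in>L2 P X T. AE \<omega> in P. \<E> s (\<E> t Q) \<omega> = \<E> s Q \<omega>) \<and>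
     (\<forall>t\<le>T. \<forall>A\<in>sets (filt P X t). \<forall>Q\<in>L2 P X T.
        AE \<omega> in P. indicator A \<omega> *\<^sub>R \<E> t Q \<omega> = \<E> t (\<lambda>\<omega>'. indicator A \<omega>' *\<^sub>R Q \<omega>') \<omega>)"

definition dynamically_monotone ::
  "'w measure \<Rightarrow> (nat \<Rightarrow> 'w \<Rightarrow> real^'n) \<Rightarrow> nat \<Rightarrow> (nat \<Rightarrow> ('w \<Rightarrow> real^'k) set) \<Rightarrow>
   (nat \<Rightarrow> ('w \<Rightarrow> real^'k) \<Rightarrow> ('w \<Rightarrow> real^'k)) \<Rightarrow> bool" where
  "dynamically_monotone P X T \<Q> \<E> \<longleftrightarrow>
     consistent_nonlinear_expectation P X T \<Q> \<E> \<and>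
     (\<forall>t\<le>T. \<forall>s\<le>t. \<Q> s \<subseteq> \<Q> t) \<and>
     (\<forall>t\<le>T. \<forall>s\<le>t. \<forall>Q\<in>\<Q> s. \<E> t Q \<in> \<Q> s)"

definition translation_invariant ::
  "'w measure \<Rightarrow> (nat \<Rightarrow> 'w \<Rightarrow> real^'n) \<Rightarrow> nat \<Rightarrow>
   (nat \<Rightarrow> ('w \<Rightarrow> real^'k) \<Rightarrow> ('w \<Rightarrow> real^'k)) \<Rightarrow> bool" where
  "translation_invariant P X T \<E> \<longleftrightarrow>
     (\<forall>t\<le>T. \<forall>Q\<in>L2 P X T. \<forall>q\<in>L2 P X t.
        AE \<omega> in P. \<E> t (\<lambda>\<omega>'. Q \<omega>' + q \<omega>') \<omega> = \<E> t Q \<omega> + q \<omega>)"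


text \<open>All requirements placed on \<open>F\<close>: it is balanced, independent of \<open>Y\<close>, normalised, and its BSDE
  solutions are given by \<open>\<E>\<close>.\<close>
definition represents ::
  "'w measure \<Rightarrow> (nat \<Rightarrow> 'w \<Rightarrow> real^'n) \<Rightarrow> nat \<Rightarrow> (nat \<Rightarrow> ('w \<Rightarrow> real^'k) set) \<Rightarrow>
   (nat \<Rightarrow> ('w \<Rightarrow> real^'k) \<Rightarrow> ('w \<Rightarrow> real^'k)) \<Rightarrow> ('w, 'k::finite, 'n::finite) driver_fun \<Rightarrow> bool" where
  "represents P X T \<Q> \<E> F \<longleftrightarrow>
     balanced_driver P X T \<Q> F \<and> independent_of_Y P X T F \<and> normalised_driver P X T F \<and>
     (\<forall>Q\<in>L2 P X T. \<exists>Z. bsde_solution P X T F Q (\<lambda>t. \<E> t Q) Z)"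

end

theory Submission
  imports Defs
begin

text \<open>
  Up to null sets an \<open>\<F>\<^sub>t\<close>-measurable function is a function of the history \<open>X\<^sub>0, \<dots>, X\<^sub>t\<close>, which
  takes finitely many values.  Hence every \<open>\<F>\<^sub>t\<^sub>+\<^sub>1\<close>-measurable \<open>W\<close> has the form
  \<open>Z\<^sub>t X\<^sub>t\<^sub>+\<^sub>1 = Z\<^sub>t M\<^sub>t\<^sub>+\<^sub>1 + c\<close> with \<open>Z\<^sub>t\<close> and \<open>c\<close> \<open>\<F>\<^sub>t\<close>-measurable.  For \<open>W = \<E>(Q | \<F>\<^sub>t\<^sub>+\<^sub>1)\<close>, translation
  invariance and recursivity give \<open>\<E>(Q | \<F>\<^sub>t) = \<E>(Z\<^sub>t M\<^sub>t\<^sub>+\<^sub>1 | \<F>\<^sub>t) + c\<close>, which is one step of the BSDE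
  with driver \<open>F(\<omega>,t,y,z) = \<E>(z M\<^sub>t\<^sub>+\<^sub>1 | \<F>\<^sub>t)\<close>.  Balancedness is strict monotonicity of \<open>\<E>\<close> applied to
  \<open>Z\<^sup>1\<^sub>t M\<^sub>t\<^sub>+\<^sub>1 \<ge> Z\<^sup>2\<^sub>t M\<^sub>t\<^sub>+\<^sub>1 + c\<close>, where \<open>c\<close> is the minimum over the possible jumps.  Conversely, as
  \<open>M\<^sub>t\<^sub>+\<^sub>1\<close> is centred, each step of the BSDE determines \<open>Y\<^sub>t\<close> and \<open>Z\<^sub>t M\<^sub>t\<^sub>+\<^sub>1\<close> from \<open>Y\<^sub>t\<^sub>+\<^sub>1\<close>, compatibly
  with adding an \<open>\<F>\<^sub>t\<close>-measurable \<open>q\<close> if the driver does not depend on \<open>Y\<close>.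
\<close>

section \<open>Measurability with respect to a finite history\<close>

locale basis_process = prob_space P for P :: "'w measure" +
  fixes X :: "nat \<Rightarrow> 'w \<Rightarrow> real^'n" and T :: nat
  assumes X_measurable: "\<And>t. t \<le> T \<Longrightarrow> X t \<in> borel_measurable P"
    and X_basis: "\<And>t \<omega>. t \<le> T \<Longrightarrow> \<omega> \<in> space P \<Longrightarrow> X t \<omega> \<in> range (\<lambda>j. axis j 1)"
begin

abbreviation "\<F> t \<equiv> filt P X t"
abbreviation "M t \<equiv> mart_diff P X t"

text \<open>The sigma-algebra before completion. Its sets are saturated for \<open>hist t\<close>, a
  property that null sets can destroy, so histories are studied here first and the results are then
  transferred to \<open>\<F> t\<close>.\<close>

definition gen :: "nat \<Rightarrow> 'w measure" where
  "gen t = sigma (space P) {X s -` B \<inter> space P | s B. s \<le> t \<and> B \<in> sets borel}"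

definition hist :: "nat \<Rightarrow> 'w \<Rightarrow> (real^'n) list" where
  "hist t \<omega> = map (\<lambda>s. X s \<omega>) [0..<Suc t]"

lemma filt_eq: "\<F> t = completion (restr_to_subalg P (gen t))"
  by (simp add: filt_def gen_def)

lemma space_gen [simp]: "space (gen t) = space P"
  unfolding gen_def by (intro space_measure_of) auto

lemma sets_gen:
  "sets (gen t) = sigma_sets (space P) {X s -` B \<inter> space P | s B. s \<le> t \<and> B \<in> sets borel}"
  unfolding gen_def by (intro sets_measure_of) auto

lemma subalgebra_gen: "t \<le> T \<Longrightarrow> subalgebra P (gen t)"
  unfolding subalgebra_def sets_gen
  by (auto intro!: sets.sigma_sets_subset measurable_sets[OF X_measurable])

lemma space_filt [simp]: "space (\<F> t) = space P"
  by (simp add: filt_eq space_restr_to_subalg)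

lemma sets_gen_mono: "s \<le> t \<Longrightarrow> sets (gen s) \<subseteq> sets (gen t)"
  unfolding sets_gen by (intro sigma_sets_mono') (auto intro: order_trans)

section \<open>Null sets of the completed filtration\<close>

text \<open>Completing a measure does not change which properties hold a.e. The covering null set
  has to lie in \<open>gen t\<close>: an \<open>\<F> t\<close>-measurable function may be altered on
  such a set, but not on an arbitrary \<open>P\<close>-null set.\<close>

lemma filt_null_iff:
  assumes "t \<le> T"
  shows "(AE \<omega> in \<F> t. R \<omega>) \<longleftrightarrow> (\<exists>N \<in> null_sets P \<inter> sets (gen t). {\<omega>\<in>space P. \<not> R \<omega>} \<subseteq> N)"
proof -
  have "(AE \<omega> in \<F> t. R \<omega>) \<longleftrightarrow> (AE \<omega> in restr_to_subalg P (gen t). R \<omega>)"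
    unfolding filt_eq by (rule AE_completion_iff)
  then show ?thesis
    unfolding eventually_ae_filter null_sets_restr_to_subalg[OF subalgebra_gen[OF assms]]
      space_restr_to_subalg by simp
qed

lemma AE_filtD:
  assumes "t \<le> T" "AE \<omega> in \<F> t. R \<omega>"
  shows "AE \<omega> in P. R \<omega>"
proof -
  obtain N where "N \<in> null_sets P" "{\<omega>\<in>space P. \<not> R \<omega>} \<subseteq> N"
    using assms(2) unfolding filt_null_iff[OF assms(1)] by auto
  then show ?thesis by (rule AE_I')
qed

lemma AE_filt_mono:
  assumes "s \<le> t" "t \<le> T" "AE \<omega> in \<F> s. R \<omega>"
  shows "AE \<omega> in \<F> t. R \<omega>"
proof -
  obtain N where "N \<in> null_sets P" "N \<in> sets (gen s)" "{\<omega>\<in>space P. \<not> R \<omega>} \<subseteq> N"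
    using assms(3) unfolding filt_null_iff[OF order_trans[OF assms(1,2)]] by auto
  then show ?thesis
    unfolding filt_null_iff[OF assms(2)] using sets_gen_mono[OF assms(1)] by blast
qed

text \<open>A completed set is a set of \<open>P\<close> together with part of a
  \<open>P\<close>-null set. It need not be \<open>P\<close>-measurable, hence the comparison with
  \<open>completion P\<close>.\<close>

lemma subalgebra_filt:
  assumes "t \<le> T"
  shows "subalgebra (completion P) (\<F> t)"
  unfolding subalgebra_def
proof (intro conjI subsetI)
  fix A assume "A \<in> sets (\<F> t)"
  then obtain S N N' where "A = S \<union> N" "N \<subseteq> N'" "N' \<in> null_sets P" "S \<in> sets P"
    unfolding filt_eq
    using subalgebra_gen[OF assms]
    by (force elim!: sets_completionE simp: null_sets_restr_to_subalg sets_restr_to_subalg subalgebra_def)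
  then show "A \<in> sets (completion P)" by (rule sets_completionI)
qed simp

section \<open>Finite histories\<close>

lemma hist_eq_iff: "hist t \<omega> = hist t \<omega>' \<longleftrightarrow> (\<forall>s\<le>t. X s \<omega> = X s \<omega>')"
  by (auto simp: hist_def less_Suc_eq_le)

lemma hist_Suc: "hist (Suc t) \<omega> = hist t \<omega> @ [X (Suc t) \<omega>]"
  by (simp add: hist_def)

lemma hist_take: "s \<le> t \<Longrightarrow> hist s \<omega> = take (Suc s) (hist t \<omega>)"
  by (simp add: hist_def take_map take_upt del: upt_Suc)

lemma finite_hists:
  assumes "t \<le> T"
  shows "finite (hist t ` space P)"
proof (rule finite_subset)
  show "hist t ` space P \<subseteq>
      {xs. set xs \<subseteq> range (\<lambda>j. axis j 1) \<and> length xs = Suc t}"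
    using X_basis assms by (auto simp: hist_def less_Suc_eq_le simp del: upt_Suc)
qed (auto intro: finite_lists_length_eq)

text \<open>\<open>hist t\<close> has finitely many values, so only its level sets matter, and each
  is a finite intersection of generators of \<open>gen t\<close>.\<close>

lemma hist_measurable:
  assumes "t \<le> T"
  shows "hist t \<in> measurable (gen t) (count_space UNIV)"
proof -
  have "hist t -` {hist t \<omega>} \<inter> space P \<in> sets (gen t)" if "\<omega> \<in> space P" for \<omega>
  proof -
    have "hist t -` {hist t \<omega>} \<inter> space P = (\<Inter>s\<in>{..t}. X s -` {X s \<omega>} \<inter> space P)"
      by (auto simp: hist_eq_iff)
    moreover have "X s -` {X s \<omega>} \<inter> space P \<in> sets (gen t)" if "s \<le> t" for s
      unfolding sets_gen using that
      by (intro sigma_sets.Basic CollectI exI[of _ s] exI[of _ "{X s \<omega>}"]) auto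
    ultimately show ?thesis
      by (simp only:) (intro sets.finite_INT, auto)
  qed
  then have "hist t \<in> measurable (gen t) (count_space (hist t ` space P))"
    using finite_hists[OF assms] by (subst measurable_count_space_eq2) auto
  then show ?thesis
    by (rule measurable_compose[where g="\<lambda>x. x"]) simp
qed

section \<open>Measurability as dependence on the history\<close>

text \<open>A generator depends on \<open>\<omega>\<close> only through \<open>X s\<close> for some
  \<open>s \<le> t\<close>, and saturation persists under complements and countable unions.\<close>

lemma gen_saturated:
  assumes "A \<in> sets (gen t)" "\<omega> \<in> space P" "\<omega>' \<in> space P" "hist t \<omega> = hist t \<omega>'"
  shows "\<omega> \<in> A \<longleftrightarrow> \<omega>' \<in> A"
  using assms(1) unfolding sets_gen
  by induction (use assms(2-) in \<open>auto simp: hist_eq_iff\<close>)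

text \<open>The level set of \<open>f\<close> through a point is saturated, so \<open>f\<close> is
  constant on histories and \<open>g\<close> may read it off at any representative. The T1 axiom
  makes points closed and so level sets measurable.\<close>

lemma gen_measurable_hist:
  fixes f :: "'w \<Rightarrow> 'b::t1_space"
  assumes "f \<in> borel_measurable (gen t)"
  shows "\<exists>g. \<forall>\<omega>\<in>space P. f \<omega> = g (hist t \<omega>)"
proof (intro exI ballI)
  let ?g = "\<lambda>l. f (SOME \<omega>. \<omega> \<in> space P \<and> hist t \<omega> = l)"
  fix \<omega> assume \<omega>: "\<omega> \<in> space P"
  define \<omega>' where "\<omega>' = (SOME \<omega>'. \<omega>' \<in> space P \<and> hist t \<omega>' = hist t \<omega>)"
  have \<omega>': "\<omega>' \<in> space P \<and> hist t \<omega>' = hist t \<omega>"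
    unfolding \<omega>'_def by (rule someI[of _ \<omega>]) (use \<omega> in auto)
  have "f -` {f \<omega>} \<inter> space P \<in> sets (gen t)"
    using measurable_sets[OF assms, of "{f \<omega>}"] by simp
  from gen_saturated[OF this, of \<omega> \<omega>'] have "f \<omega> = f \<omega>'"
    using \<omega> \<omega>' by simp
  then show "f \<omega> = ?g (hist t \<omega>)" unfolding \<omega>'_def .
qed

text \<open>The history has finitely many values, each taken on a measurable set, so an arbitrary
  \<open>g\<close> gives a measurable function, and the completion absorbs the exceptional
  set.\<close>

lemma filt_measurableI:
  fixes f :: "'w \<Rightarrow> 'b::topological_space"
  assumes "t \<le> T" "AE \<omega> in \<F> t. f \<omega> = g (hist t \<omega>)"
  shows "f \<in> borel_measurable (\<F> t)"
proof (rule measurableI)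
  fix B :: "'b set" assume B: "B \<in> sets borel"
  obtain N where N: "N \<in> null_sets P" "N \<in> sets (gen t)" "{\<omega>\<in>space P. f \<omega> \<noteq> g (hist t \<omega>)} \<subseteq> N"
    using assms by (auto simp: filt_null_iff)
  have sg: "sets (restr_to_subalg P (gen t)) = sets (gen t)"
    using assms(1) by (intro sets_restr_to_subalg subalgebra_gen)
  have "(\<lambda>\<omega>. g (hist t \<omega>)) \<in> borel_measurable (gen t)"
    using hist_measurable[OF assms(1)] by (rule measurable_compose) simp
  from measurable_sets[OF this B]
  have *: "(\<lambda>\<omega>. g (hist t \<omega>)) -` B \<inter> space P \<in> sets (gen t)" by simp
  show "f -` B \<inter> space (\<F> t) \<in> sets (\<F> t)"
    unfolding filt_eq
  proof (rule sets_completionI)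
    \<comment> \<open>Off \<open>N\<close> the two preimages agree; what remains lies inside the
      null set \<open>N\<close>.\<close>
    show "f -` B \<inter> space (completion (restr_to_subalg P (gen t))) =
       ((\<lambda>\<omega>. g (hist t \<omega>)) -` B \<inter> space P - N) \<union> (f -` B \<inter> space P \<inter> N)"
      using N(3) by (auto simp: space_restr_to_subalg)
    show "N \<in> null_sets (restr_to_subalg P (gen t))"
      using N assms(1) by (simp add: null_sets_restr_to_subalg subalgebra_gen)
    show "(\<lambda>\<omega>. g (hist t \<omega>)) -` B \<inter> space P - N \<in> sets (restr_to_subalg P (gen t))"
      using * N sg by auto
  qed auto
qed simp

lemma filt_measurable_hist_real:
  fixes f :: "'w \<Rightarrow> real"
  assumes "t \<le> T" "f \<in> borel_measurable (\<F> t)"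
  shows "\<exists>g. AE \<omega> in \<F> t. f \<omega> = g (hist t \<omega>)"
proof -
  obtain h where h: "h \<in> borel_measurable (restr_to_subalg P (gen t))"
    "AE \<omega> in restr_to_subalg P (gen t). f \<omega> = h \<omega>"
    using completion_ex_borel_measurable_real[OF assms(2)[unfolded filt_eq]] by blast
  have "h \<in> borel_measurable (gen t)"
    using subalgebra_gen[OF assms(1)] h(1) by (rule measurable_in_subalg')
  from gen_measurable_hist[OF this] obtain g where g: "\<forall>\<omega>\<in>space P. h \<omega> = g (hist t \<omega>)" ..
  have "AE \<omega> in \<F> t. f \<omega> = h \<omega>"
    using h(2) unfolding filt_eq by (rule AE_completion)
  then have "AE \<omega> in \<F> t. f \<omega> = g (hist t \<omega>)"
    using AE_space by eventually_elim (use g in simp)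
  then show ?thesis by (rule exI[of _ g])
qed

text \<open>Coordinates reduce this to the real case; the basis is finite, so the exceptional sets
  unite to a null set.\<close>

lemma filt_measurable_hist:
  fixes f :: "'w \<Rightarrow> 'b::euclidean_space"
  assumes "t \<le> T" "f \<in> borel_measurable (\<F> t)"
  shows "\<exists>g. AE \<omega> in \<F> t. f \<omega> = g (hist t \<omega>)"
proof -
  have "\<exists>g. AE \<omega> in \<F> t. f \<omega> \<bullet> b = g (hist t \<omega>)" for b
    using assms by (intro filt_measurable_hist_real borel_measurable_inner) auto
  then obtain g where "\<And>b. AE \<omega> in \<F> t. f \<omega> \<bullet> b = g b (hist t \<omega>)"
    by metis
  then have "AE \<omega> in \<F> t. \<forall>b\<in>Basis. f \<omega> \<bullet> b = g b (hist t \<omega>)"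
    by (simp add: AE_finite_all)
  then have "AE \<omega> in \<F> t. f \<omega> = (\<Sum>b\<in>Basis. g b (hist t \<omega>) *\<^sub>R b)"
  proof eventually_elim
    case (elim \<omega>)
    then have "(\<Sum>b\<in>Basis. g b (hist t \<omega>) *\<^sub>R b) = (\<Sum>b\<in>Basis. (f \<omega> \<bullet> b) *\<^sub>R b)"
      by (intro sum.cong) auto
    then show ?case by (simp only: euclidean_representation)
  qed
  then show ?thesis
    by (intro exI[of _ "\<lambda>l. \<Sum>b\<in>Basis. g b l *\<^sub>R b"])
qed

lemma filt_measurable_mono:
  fixes f :: "'w \<Rightarrow> 'b::euclidean_space"
  assumes "s \<le> t" "t \<le> T" "f \<in> borel_measurable (\<F> s)"
  shows "f \<in> borel_measurable (\<F> t)"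
proof -
  obtain g where "AE \<omega> in \<F> s. f \<omega> = g (hist s \<omega>)"
    using filt_measurable_hist[OF order_trans[OF assms(1,2)] assms(3)] ..
  from AE_filt_mono[OF assms(1,2) this] show ?thesis
    using assms by (intro filt_measurableI[where g="\<lambda>l. g (take (Suc s) l)"]) (auto simp: hist_take)
qed

lemma filt_bounded:
  fixes f :: "'w \<Rightarrow> 'b::euclidean_space"
  assumes "t \<le> T" "f \<in> borel_measurable (\<F> t)"
  obtains C where "AE \<omega> in P. norm (f \<omega>) \<le> C"
proof -
  obtain g where g: "AE \<omega> in \<F> t. f \<omega> = g (hist t \<omega>)"
    using filt_measurable_hist[OF assms] ..
  obtain C where C: "\<And>l. l \<in> hist t ` space P \<Longrightarrow> norm (g l) \<le> C"
    using finite_imp_bounded[OF finite_imageI[OF finite_hists[OF assms(1)], of g]]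
    unfolding bounded_iff by blast
  have "AE \<omega> in P. norm (f \<omega>) \<le> C"
    using AE_filtD[OF assms(1) g] AE_space by eventually_elim (auto intro: C)
  then show thesis ..
qed

lemma filt_integrable:
  fixes f :: "'w \<Rightarrow> 'b::euclidean_space"
  assumes "t \<le> T" "f \<in> borel_measurable (\<F> t)"
  shows "integrable (completion P) f"
proof -
  interpret C: prob_space "completion P" by (rule prob_space_completion)
  obtain C where "AE \<omega> in P. norm (f \<omega>) \<le> C"
    using assms by (rule filt_bounded)
  then show ?thesis
    using measurable_from_subalg[OF subalgebra_filt assms(2)] assms(1)
    by (intro C.integrable_const_bound[where B=C]) (auto simp: AE_completion)
qed

text \<open>Together with \<open>L2_eq\<close> this is the coincidence of the L-spaces for finitely
  many paths. Afterwards \<open>\<F> t\<close>-measurability is the only condition to check.\<close>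

lemma Linf_eq: "t \<le> T \<Longrightarrow> Linf P X t = borel_measurable (\<F> t)"
  unfolding Linf_def by (auto elim: filt_bounded)

lemma L2_eq: "t \<le> T \<Longrightarrow> L2 P X t = borel_measurable (\<F> t)"
  unfolding L2_def by (auto intro!: filt_integrable)

lemma X_filt: "t \<le> T \<Longrightarrow> X t \<in> borel_measurable (\<F> t)"
  by (rule filt_measurableI[where g=last]) (auto simp: hist_def)

lemma cond_mean_filt: "cond_mean P X t (f :: 'w \<Rightarrow> real^'m) \<in> borel_measurable (\<F> t)"
proof (rule iffD2[OF borel_measurable_euclidean_space], rule ballI)
  fix b :: "real^'m" assume "b \<in> Basis"
  then obtain i where "b = axis i 1" by (auto simp: Basis_vec_def)
  then have "(\<lambda>\<omega>. cond_mean P X t f \<omega> \<bullet> b) = real_cond_exp (completion P) (\<F> t) (\<lambda>\<omega>. f \<omega> $ i)"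
    by (simp add: cond_mean_def inner_axis fun_eq_iff)
  then show "(\<lambda>\<omega>. cond_mean P X t f \<omega> \<bullet> b) \<in> borel_measurable (\<F> t)"
    by (simp only: borel_measurable_cond_exp)
qed

text \<open>\<open>f\<close> and \<open>g\<close> are a.e. functions of the finite history, hence so
  is their image under an arbitrary map \<open>h\<close>.\<close>

lemma filt_combine:
  fixes f :: "'w \<Rightarrow> 'b::euclidean_space" and g :: "'w \<Rightarrow> 'c::euclidean_space"
    and h :: "'b \<Rightarrow> 'c \<Rightarrow> 'd::topological_space"
  assumes t: "t \<le> T" and f: "f \<in> borel_measurable (\<F> t)" and g: "g \<in> borel_measurable (\<F> t)"
  shows "(\<lambda>\<omega>. h (f \<omega>) (g \<omega>)) \<in> borel_measurable (\<F> t)"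
proof -
  obtain f' where f': "AE \<omega> in \<F> t. f \<omega> = f' (hist t \<omega>)"
    using filt_measurable_hist[OF t f] ..
  obtain g' where "AE \<omega> in \<F> t. g \<omega> = g' (hist t \<omega>)"
    using filt_measurable_hist[OF t g] ..
  with f' have "AE \<omega> in \<F> t. h (f \<omega>) (g \<omega>) = h (f' (hist t \<omega>)) (g' (hist t \<omega>))"
    by eventually_elim simp
  then show ?thesis
    by (intro filt_measurableI[OF t, where g="\<lambda>l. h (f' l) (g' l)"])
qed

lemma filt_compose:
  fixes f :: "'w \<Rightarrow> 'b::euclidean_space" and h :: "'b \<Rightarrow> 'd::topological_space"
  assumes "t \<le> T" "f \<in> borel_measurable (\<F> t)"
  shows "(\<lambda>\<omega>. h (f \<omega>)) \<in> borel_measurable (\<F> t)"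
  using filt_combine[OF assms assms(2), of "\<lambda>x _. h x"] .

section \<open>The martingale differences\<close>

lemma mart_diff_filt: "t < T \<Longrightarrow> M (t + 1) \<in> borel_measurable (\<F> (t + 1))"
  unfolding mart_diff_def[abs_def]
  by (intro borel_measurable_diff X_filt filt_measurable_mono[OF _ _ cond_mean_filt]) auto

lemma finite_measure_subalgebra_filt: "t \<le> T \<Longrightarrow> finite_measure_subalgebra (completion P) (\<F> t)"
  using prob_space_completion subalgebra_filt
  by (auto simp: finite_measure_subalgebra_def finite_measure_subalgebra_axioms_def prob_space_def)

text \<open>Conditioning on \<open>\<F> t\<close> sends \<open>z \<bullet> M (t + 1)\<close> to zero
  and fixes \<open>c\<close>. This is the uniqueness principle behind each BSDE step: an
  \<open>\<F> t\<close>-measurable martingale increment vanishes.\<close>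

lemma mart_diff_centred:
  fixes z :: "'w \<Rightarrow> real^'n"
  assumes t: "t < T" and z: "z \<in> borel_measurable (\<F> t)" and c: "c \<in> borel_measurable (\<F> t)"
    and eq: "AE \<omega> in P. z \<omega> \<bullet> M (t + 1) \<omega> = c \<omega>"
  shows "AE \<omega> in P. c \<omega> = 0"
proof -
  interpret S: finite_measure_subalgebra "completion P" "\<F> t"
    using t by (simp add: finite_measure_subalgebra_filt)
  let ?E = "real_cond_exp (completion P) (\<F> t)"
  let ?x = "\<lambda>j \<omega>. X (t + 1) \<omega> $ j"
  \<comment> \<open>\<open>g\<close> is the compensator of \<open>z \<bullet> X (t + 1)\<close>, so
    the hypothesis reads \<open>z \<bullet> X (t + 1) = c + g\<close>; both sides are conditioned
    below.\<close>
  define g where "g \<omega> = z \<omega> \<bullet> cond_mean P X t (X (t + 1)) \<omega>" for \<omega>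
  have t1: "t + 1 \<le> T" "t \<le> T" using t by auto
  have g: "g \<in> borel_measurable (\<F> t)"
    unfolding g_def[abs_def] by (rule filt_combine[OF t1(2) z cond_mean_filt])
  have zx: "(\<lambda>\<omega>. z \<omega> $ j * ?x j \<omega>) \<in> borel_measurable (\<F> (t + 1))" for j
    using filt_combine[OF t1(1) filt_measurable_mono[OF _ t1(1) z] X_filt[OF t1(1)], of "\<lambda>a b. a $ j * b $ j"]
    by simp
  have x: "?x j \<in> borel_measurable (\<F> (t + 1))" for j
    by (rule filt_compose[OF t1(1) X_filt[OF t1(1)]])
  have zj: "(\<lambda>\<omega>. z \<omega> $ j) \<in> borel_measurable (\<F> t)" for j
    by (rule filt_compose[OF t1(2) z])
  have CP: "f \<in> borel_measurable (completion P)"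
    if "f \<in> borel_measurable (\<F> (t + 1))" for f :: "'w \<Rightarrow> real"
    using measurable_from_subalg[OF subalgebra_filt that] t1 by simp
  have "AE \<omega> in completion P. ?E (\<lambda>\<omega>. z \<omega> $ j * ?x j \<omega>) \<omega> = z \<omega> $ j * ?E (?x j) \<omega>" for j
    by (intro S.real_cond_exp_mult zj CP x filt_integrable[OF t1(1)] zx)
  then have "AE \<omega> in completion P. \<forall>j. ?E (\<lambda>\<omega>. z \<omega> $ j * ?x j \<omega>) \<omega> = z \<omega> $ j * ?E (?x j) \<omega>"
    by (simp add: AE_all_countable)
  moreover have "AE \<omega> in completion P.
      ?E (\<lambda>\<omega>. \<Sum>j\<in>UNIV. z \<omega> $ j * ?x j \<omega>) \<omega> = (\<Sum>j\<in>UNIV. ?E (\<lambda>\<omega>. z \<omega> $ j * ?x j \<omega>) \<omega>)"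
    by (intro S.real_cond_exp_sum filt_integrable[OF t1(1)] zx)
  moreover have "AE \<omega> in completion P. (\<Sum>j\<in>UNIV. z \<omega> $ j * ?x j \<omega>) = c \<omega> + g \<omega>"
    using AE_completion[OF eq]
  proof eventually_elim
    case (elim \<omega>)
    then have "z \<omega> \<bullet> X (t + 1) \<omega> = c \<omega> + g \<omega>"
      by (simp add: mart_diff_def g_def inner_diff_right)
    then show ?case by (simp only: inner_vec_def inner_real_def)
  qed
  then have "AE \<omega> in completion P. ?E (\<lambda>\<omega>. \<Sum>j\<in>UNIV. z \<omega> $ j * ?x j \<omega>) \<omega> = ?E (\<lambda>\<omega>. c \<omega> + g \<omega>) \<omega>"
    by (rule S.real_cond_exp_cong)
      (intro CP borel_measurable_sum borel_measurable_add zx filt_measurable_mono[OF _ t1(1) c]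
        filt_measurable_mono[OF _ t1(1) g] le_add1)+
  moreover have "AE \<omega> in completion P. ?E (\<lambda>\<omega>. c \<omega> + g \<omega>) \<omega> = c \<omega> + g \<omega>"
    using c g by (intro S.real_cond_exp_F_meas filt_integrable[OF t1(2)]) auto
  ultimately have "AE \<omega> in completion P. c \<omega> = 0"
  proof eventually_elim
    case (elim \<omega>)
    have "g \<omega> = (\<Sum>j\<in>UNIV. z \<omega> $ j * ?E (?x j) \<omega>)"
      by (simp only: g_def inner_vec_def inner_real_def cond_mean_def vec_lambda_beta)
    with elim show ?case by simp
  qed
  then show ?thesis by (simp add: AE_completion_iff)
qed

text \<open>For fixed \<open>j\<close>, the event that the state \<open>j\<close> is reached
  although its conditional probability is not positive has probability at most zero;
  \<open>j\<close> ranges over a finite set.\<close>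

lemma jump_possible:
  assumes t: "t < T"
  shows "AE \<omega> in P. \<forall>j. X (t + 1) \<omega> = axis j 1 \<longrightarrow> j \<in> possible_jumps P X t \<omega>"
proof -
  interpret S: finite_measure_subalgebra "completion P" "\<F> t"
    using t by (simp add: finite_measure_subalgebra_filt)
  have "AE \<omega> in P. X (t + 1) \<omega> = axis j 1 \<longrightarrow> j \<in> possible_jumps P X t \<omega>" for j
  proof -
    define f :: "'w \<Rightarrow> real" where "f = indicator {\<omega> \<in> space P. X (t + 1) \<omega> = axis j 1}"
    define p where "p = real_cond_exp (completion P) (\<F> t) f"
    define B where "B = {\<omega> \<in> space P. p \<omega> \<le> 0}"
    have p: "p \<in> borel_measurable (\<F> t)" by (simp add: p_def)
    have B: "B \<in> sets (\<F> t)"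
      using measurable_sets[OF p, of "{..0}"] by (simp add: B_def vimage_def Int_def conj_commute)
    have "{\<omega> \<in> space P. X (t + 1) \<omega> = axis j 1} \<in> sets P"
      using measurable_sets[OF X_measurable, of "t + 1" "{axis j 1}"] t
      by (simp add: vimage_def Int_def conj_commute)
    then have "f \<in> borel_measurable (completion P)"
      unfolding f_def by (intro measurable_completion borel_measurable_indicator)
    then have f: "integrable (completion P) f"
      by (rule S.integrable_const_bound[where B=1, rotated]) (simp add: f_def)
    have B': "B \<in> sets (completion P)"
      using B subalgebra_filt[of t] t by (auto simp: subalgebra_def)
    have fB: "integrable (completion P) (\<lambda>\<omega>. indicator B \<omega> * f \<omega>)"
      using integrable_mult_indicator[OF B' f] by simp
    \<comment> \<open>\<open>B\<close> lies in \<open>\<F> t\<close>, so \<open>f\<close> may be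
      replaced by its conditional expectation \<open>p\<close>, which is nonpositive on
      \<open>B\<close>.\<close>
    have "(\<integral>\<omega>. indicator B \<omega> * f \<omega> \<partial>completion P) = (\<integral>\<omega>. indicator B \<omega> * p \<omega> \<partial>completion P)"
      using S.real_cond_exp_intA[OF f B] by (simp add: set_lebesgue_integral_def p_def)
    also have "\<dots> \<le> 0"
      using integral_nonneg_AE[OF AE_I2, of "completion P" "\<lambda>\<omega>. - (indicator B \<omega> * p \<omega>)"]
      by (simp add: B_def indicator_def)
    finally have "(\<integral>\<omega>. indicator B \<omega> * f \<omega> \<partial>completion P) = 0"
      by (intro antisym integral_nonneg_AE AE_I2) (auto simp: f_def)
    then have "AE \<omega> in completion P. indicator B \<omega> * f \<omega> = 0"
      by (subst (asm) integral_nonneg_eq_0_iff_AE[OF fB]) (auto simp: f_def)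
    then have "AE \<omega> in P. indicator B \<omega> * f \<omega> = 0" by (simp add: AE_completion_iff)
    then show ?thesis
      using AE_space by eventually_elim
        (auto simp: possible_jumps_def f_def B_def p_def indicator_def split: if_splits)
  qed
  then show ?thesis by (simp add: AE_all_countable)
qed

section \<open>Random parameters and one-step expansions\<close>

text \<open>A fixed history fixes the parameter, so only finitely many \<open>f z\<close> are
  involved and their exceptional sets unite to a null set. This replaces joint measurability in the
  parameter and \<open>\<omega>\<close>.\<close>

lemma filt_random_parameter:
  fixes f :: "'b::euclidean_space \<Rightarrow> 'w \<Rightarrow> 'c::euclidean_space"
  assumes t: "t \<le> T" and f: "\<And>z. f z \<in> borel_measurable (\<F> t)" and Z: "Z \<in> borel_measurable (\<F> t)"
  shows "(\<lambda>\<omega>. f (Z \<omega>) \<omega>) \<in> borel_measurable (\<F> t)"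
proof -
  obtain k where k: "AE \<omega> in \<F> t. Z \<omega> = k (hist t \<omega>)"
    using filt_measurable_hist[OF t Z] ..
  obtain G where G: "\<And>z. AE \<omega> in \<F> t. f z \<omega> = G z (hist t \<omega>)"
    using filt_measurable_hist[OF t f] by metis
  have "AE \<omega> in \<F> t. \<forall>l\<in>hist t ` space P. f (k l) \<omega> = G (k l) (hist t \<omega>)"
    by (intro AE_finite_allI finite_hists t G)
  then have "AE \<omega> in \<F> t. f (Z \<omega>) \<omega> = G (k (hist t \<omega>)) (hist t \<omega>)"
    using k AE_space by eventually_elim auto
  then show ?thesis
    by (intro filt_measurableI[OF t, where g="\<lambda>l. G (k l) l"])
qed

lemma hist_set_filt: "t \<le> T \<Longrightarrow> {\<omega> \<in> space P. hist t \<omega> = l} \<in> sets (\<F> t)"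
  using measurable_sets[OF hist_measurable, of t "{l}"]
  by (auto simp: filt_eq sets_restr_to_subalg subalgebra_gen vimage_def Int_def conj_commute
      intro!: sets_completionI_sets)

lemma matrix_mult_filt:
  fixes Z :: "'w \<Rightarrow> real^'n^'k"
  assumes "t < T" "Z \<in> borel_measurable (\<F> t)"
  shows "(\<lambda>\<omega>. Z \<omega> *v M (t + 1) \<omega>) \<in> borel_measurable (\<F> (t + 1))"
  using assms
  by (intro filt_combine[where h="(*v)"] mart_diff_filt filt_measurable_mono[OF _ _ assms(2)]) auto

text \<open>Since \<open>X\<close> takes values in the basis, the columns of \<open>Z\<close> are the values of \<open>W\<close> at the possible next states.\<close>
lemma next_step_representation:
  fixes W :: "'w \<Rightarrow> real^'k"
  assumes t: "t < T" and W: "W \<in> borel_measurable (\<F> (t + 1))"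
  shows "\<exists>Z \<in> borel_measurable (\<F> t). AE \<omega> in P. W \<omega> = Z \<omega> *v X (t + 1) \<omega>"
proof -
  obtain g where g: "AE \<omega> in \<F> (t + 1). W \<omega> = g (hist (t + 1) \<omega>)"
    using filt_measurable_hist[OF _ W] t by auto
  define Z :: "'w \<Rightarrow> real^'n^'k" where "Z \<omega> = (\<chi> i j. g (hist t \<omega> @ [axis j 1]) $ i)" for \<omega>
  have "Z \<in> borel_measurable (\<F> t)"
    using t by (intro filt_measurableI[where g="\<lambda>l. \<chi> i j. g (l @ [axis j 1]) $ i"]) (auto simp: Z_def)
  moreover have "AE \<omega> in P. W \<omega> = g (hist (t + 1) \<omega>)"
    using AE_filtD[OF _ g] t by simp
  then have "AE \<omega> in P. W \<omega> = Z \<omega> *v X (t + 1) \<omega>"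
    using AE_space
  proof eventually_elim
    case (elim \<omega>)
    obtain j where j: "X (t + 1) \<omega> = axis j 1"
      using X_basis[of "t + 1" \<omega>] elim t by auto
    with elim have "W \<omega> = g (hist t \<omega> @ [axis j 1])"
      by (simp add: hist_Suc)
    then show ?case
      unfolding j matrix_vector_mult_basis by (simp add: Z_def column_def vec_eq_iff)
  qed
  ultimately show ?thesis by blast
qed

section \<open>BSDE solutions\<close>

text \<open>Subtracting the equations at \<open>t\<close> and \<open>t + 1\<close> gives the
  one-step recursion; conversely the equations follow from it by backward induction from
  \<open>T\<close>.\<close>

lemma bsde_solution_iff:
  "bsde_solution P X T F Q Y Z \<longleftrightarrow>
     adapted P X T Y \<and> adapted P X T Z \<and> (AE \<omega> in P. Y T \<omega> = Q \<omega>) \<and>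
     (\<forall>t<T. AE \<omega> in P. Y (t + 1) \<omega> = Y t \<omega> - F \<omega> t (Y t \<omega>) (Z t \<omega>) + Z t \<omega> *v M (t + 1) \<omega>)"
    (is "_ \<longleftrightarrow> _ \<and> _ \<and> ?end \<and> ?step")
proof -
  let ?L = "\<lambda>t \<omega>. Y t \<omega> - (\<Sum>u = t..<T. F \<omega> u (Y u \<omega>) (Z u \<omega>)) + (\<Sum>u = t..<T. Z u \<omega> *v M (u + 1) \<omega>)"
  \<comment> \<open>The sums from \<open>t\<close> and from \<open>t + 1\<close> differ by their
    first terms; \<open>Y (t + 1)\<close> is inserted to exhibit the one-step equation.\<close>
  have split: "?L t \<omega> = ?L (t + 1) \<omega> - Y (t + 1) \<omega> +
      (Y t \<omega> - F \<omega> t (Y t \<omega>) (Z t \<omega>) + Z t \<omega> *v M (t + 1) \<omega>)" if "t < T" for t \<omega>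
    using that by (simp add: sum.atLeast_Suc_lessThan)
  have "(\<forall>t\<le>T. AE \<omega> in P. ?L t \<omega> = Q \<omega>) \<longleftrightarrow> ?end \<and> ?step"
  proof (intro iffI conjI allI impI)
    assume *: "\<forall>t\<le>T. AE \<omega> in P. ?L t \<omega> = Q \<omega>"
    from *[rule_format, of T] show ?end by simp
    fix t assume t: "t < T"
    have "AE \<omega> in P. ?L t \<omega> = Q \<omega>" "AE \<omega> in P. ?L (t + 1) \<omega> = Q \<omega>"
      using * t by auto
    then show "AE \<omega> in P. Y (t + 1) \<omega> = Y t \<omega> - F \<omega> t (Y t \<omega>) (Z t \<omega>) + Z t \<omega> *v M (t + 1) \<omega>"
    proof eventually_elim
      case (elim \<omega>)
      have "c = d" if "a = b - c + d" "a = q" "b = q" for a b c d q :: "real^'k"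
        using that by (simp add: eq_diff_eq)
      from this[OF split[OF t] elim] show ?case .
    qed
  next
    assume *: "?end \<and> ?step"
    fix t assume "t \<le> T"
    then show "AE \<omega> in P. ?L t \<omega> = Q \<omega>"
    proof (induction rule: inc_induct)
      case base
      from * show ?case by simp
    next
      case (step t)
      from *[THEN conjunct2, rule_format, OF step.hyps(2)] step.IH show ?case
        by eventually_elim (subst split[OF step.hyps(2)], simp)
    qed
  qed
  then show ?thesis by (simp only: bsde_solution_def)
qed

lemma adapted_filt: "adapted P X T Y \<Longrightarrow> t \<le> T \<Longrightarrow> Y t \<in> borel_measurable (\<F> t)"
  by (simp add: adapted_def Linf_eq)

text \<open>Regularity of a driver speaks of whole processes; this embeds a variable given at one
  time, with zero elsewhere.\<close>

lemma adapted_single: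
  fixes z :: "'w \<Rightarrow> 'b::euclidean_space"
  assumes "z \<in> borel_measurable (\<F> t)"
  shows "adapted P X T (\<lambda>s. if s = t then z else (\<lambda>_. 0))"
  using assms by (auto simp: adapted_def Linf_eq)

lemma driver_filt:
  assumes "driver P X T F" "t \<le> T" "y \<in> borel_measurable (\<F> t)" "z \<in> borel_measurable (\<F> t)"
  shows "(\<lambda>\<omega>. F \<omega> t (y \<omega>) (z \<omega>)) \<in> borel_measurable (\<F> t)"
  using assms by (auto simp: driver_def Linf_eq)

text \<open>The difference of the two sides makes \<open>z' - z\<close> applied to
  \<open>M (t + 1)\<close> an \<open>\<F> t\<close>-measurable quantity, so it vanishes. Then
  \<open>z\<close> and \<open>z'\<close> are equivalent, regularity and independence of
  \<open>Y\<close> identify the driver terms, and \<open>y' = y + q\<close> remains.\<close>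

lemma bsde_step_unique:
  assumes reg: "regular_driver P X T F" and ind: "independent_of_Y P X T F" and t: "t < T"
    and meas: "y \<in> borel_measurable (\<F> t)" "y' \<in> borel_measurable (\<F> t)"
      "z \<in> borel_measurable (\<F> t)" "z' \<in> borel_measurable (\<F> t)" "q \<in> borel_measurable (\<F> t)"
    and eq: "AE \<omega> in P. y' \<omega> - F \<omega> t (y' \<omega>) (z' \<omega>) + z' \<omega> *v M (t + 1) \<omega> =
      y \<omega> - F \<omega> t (y \<omega>) (z \<omega>) + z \<omega> *v M (t + 1) \<omega> + q \<omega>"
  shows "AE \<omega> in P. y' \<omega> = y \<omega> + q \<omega>"
proof -
  have tT: "t \<le> T" using t by simp
  have drv: "driver P X T F" using reg by (simp add: regular_driver_def)
  \<comment> \<open>\<open>c\<close> collects the \<open>\<F> t\<close>-measurable terms: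
    \<open>eq\<close> says that \<open>z' - z\<close> applied to \<open>M (t + 1)\<close> is
    \<open>c\<close>.\<close>
  define c where "c \<omega> = y \<omega> - F \<omega> t (y \<omega>) (z \<omega>) + q \<omega> - (y' \<omega> - F \<omega> t (y' \<omega>) (z' \<omega>))" for \<omega>
  have c: "c \<in> borel_measurable (\<F> t)"
    unfolding c_def[abs_def]
    by (intro borel_measurable_diff borel_measurable_add driver_filt[OF drv tT] meas)
  have "AE \<omega> in P. c \<omega> $ i = 0" for i
  proof (rule mart_diff_centred[OF t, of "\<lambda>\<omega>. z' \<omega> $ i - z \<omega> $ i"])
    show "(\<lambda>\<omega>. z' \<omega> $ i - z \<omega> $ i) \<in> borel_measurable (\<F> t)"
      by (intro borel_measurable_diff filt_compose[OF tT, where h="\<lambda>x. x $ i"] meas)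
    show "(\<lambda>\<omega>. c \<omega> $ i) \<in> borel_measurable (\<F> t)"
      by (rule filt_compose[OF tT c])
    show "AE \<omega> in P. (z' \<omega> $ i - z \<omega> $ i) \<bullet> M (t + 1) \<omega> = c \<omega> $ i"
      using eq
    proof eventually_elim
      case (elim \<omega>)
      from arg_cong[OF elim, of "\<lambda>v. v $ i"] show ?case
        by (simp add: c_def inner_diff_left matrix_vector_mul_component)
    qed
  qed
  then have c0: "AE \<omega> in P. c \<omega> = 0"
    by (simp add: vec_eq_iff AE_all_countable)
  from c0 eq have "sim_at P X t z z'"
    unfolding sim_at_def
  proof eventually_elim
    case (elim \<omega>)
    have "b = b'" if "a + q - a' = 0" "a' + b' = a + b + q" for a a' b b' q :: "real^'k"
      using that by (auto simp: eq_iff_diff_eq_0[symmetric] add_ac)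
    from this[OF elim(1)[unfolded c_def] elim(2)] show ?case .
  qed
  then have "sim_process P X T (\<lambda>s. if s = t then z else (\<lambda>_. 0)) (\<lambda>s. if s = t then z' else (\<lambda>_. 0))"
    by (auto simp: sim_process_def sim_at_def)
  from reg[unfolded regular_driver_def, THEN conjunct2, THEN conjunct1, rule_format,
      OF adapted_single[OF meas(1)] adapted_single[OF meas(3)] adapted_single[OF meas(4)] this t]
  have "AE \<omega> in P. F \<omega> t (y \<omega>) (z \<omega>) = F \<omega> t (y \<omega>) (z' \<omega>)" by simp
  moreover have "AE \<omega> in P. F \<omega> t (y \<omega>) (z' \<omega>) = F \<omega> t (y' \<omega>) (z' \<omega>)"
    using ind t meas by (auto simp: independent_of_Y_def Linf_eq)
  ultimately show ?thesis
    using c0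
  proof eventually_elim
    case (elim \<omega>)
    then have "y \<omega> + q \<omega> - y' \<omega> = 0"
      by (simp add: c_def algebra_simps)
    then show ?case by (simp only: right_minus_eq)
  qed
qed

text \<open>Backward induction: \<open>q\<close> is known at every time from \<open>t\<close> on, so
  it passes through each step unchanged. For \<open>q = 0\<close> this is uniqueness of the first
  component.\<close>

lemma bsde_shift:
  assumes reg: "regular_driver P X T F" and ind: "independent_of_Y P X T F"
    and sol: "bsde_solution P X T F Q Y Z" "bsde_solution P X T F Q' Y' Z'"
    and t: "t \<le> T" and q: "q \<in> borel_measurable (\<F> t)" and Q: "AE \<omega> in P. Q' \<omega> = Q \<omega> + q \<omega>"
    and u: "t \<le> u" "u \<le> T"
  shows "AE \<omega> in P. Y' u \<omega> = Y u \<omega> + q \<omega>"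
  using u(2,1)
proof (induction rule: inc_induct)
  case base
  have "AE \<omega> in P. Y T \<omega> = Q \<omega>" "AE \<omega> in P. Y' T \<omega> = Q' \<omega>"
    using sol by (auto simp: bsde_solution_iff)
  with Q show ?case by eventually_elim simp
next
  case (step u)
  have A: "adapted P X T Y" "adapted P X T Y'" "adapted P X T Z" "adapted P X T Z'"
    using sol by (auto simp: bsde_solution_iff)
  have "AE \<omega> in P. Y (u + 1) \<omega> = Y u \<omega> - F \<omega> u (Y u \<omega>) (Z u \<omega>) + Z u \<omega> *v M (u + 1) \<omega>"
    "AE \<omega> in P. Y' (u + 1) \<omega> = Y' u \<omega> - F \<omega> u (Y' u \<omega>) (Z' u \<omega>) + Z' u \<omega> *v M (u + 1) \<omega>"
    using sol step.hyps(2) by (auto simp: bsde_solution_iff)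
  moreover have "AE \<omega> in P. Y' (u + 1) \<omega> = Y (u + 1) \<omega> + q \<omega>"
    using step by simp
  ultimately have eq: "AE \<omega> in P. Y' u \<omega> - F \<omega> u (Y' u \<omega>) (Z' u \<omega>) + Z' u \<omega> *v M (u + 1) \<omega> =
      Y u \<omega> - F \<omega> u (Y u \<omega>) (Z u \<omega>) + Z u \<omega> *v M (u + 1) \<omega> + q \<omega>"
    by eventually_elim simp
  show ?case
    using step.hyps(2) step.prems
    by (intro bsde_step_unique[OF reg ind step.hyps(2) _ _ _ _ _ eq])
      (auto intro: A[THEN adapted_filt] filt_measurable_mono[OF _ _ q])
qed

end

section \<open>Monotone nonlinear expectations and their drivers\<close>

locale monotone_expectation = basis_process P X T
  for P :: "'w measure" and X :: "nat \<Rightarrow> 'w \<Rightarrow> real^'n" and T :: nat +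
  fixes \<E> :: "nat \<Rightarrow> ('w \<Rightarrow> real^'k) \<Rightarrow> ('w \<Rightarrow> real^'k)"
    and \<Q> :: "nat \<Rightarrow> ('w \<Rightarrow> real^'k) set"
  assumes family: "operator_family P X T \<E>"
    and \<Q>_family: "L2_subset_family P X T \<Q>"
    and \<Q>_add: "\<And>t Q q. t \<le> T \<Longrightarrow> Q \<in> \<Q> t \<Longrightarrow> q \<in> Linf P X t \<Longrightarrow> (\<lambda>\<omega>. Q \<omega> + q \<omega>) \<in> \<Q> t"
    and monotone: "dynamically_monotone P X T \<Q> \<E>"
begin

section \<open>Axioms of the expectation for measurable functions\<close>

lemma consistent: "consistent_nonlinear_expectation P X T \<Q> \<E>"
  using monotone by (simp add: dynamically_monotone_def)

lemma \<E>_filt: "t \<le> T \<Longrightarrow> Q \<in> borel_measurable (\<F> T) \<Longrightarrow> \<E> t Q \<in> borel_measurable (\<F> t)"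
  using family by (simp add: operator_family_def L2_eq)

lemma \<E>_cong:
  assumes "t \<le> T" "Q \<in> borel_measurable (\<F> T)" "Q' \<in> borel_measurable (\<F> T)" "AE \<omega> in P. Q \<omega> = Q' \<omega>"
  shows "AE \<omega> in P. \<E> t Q \<omega> = \<E> t Q' \<omega>"
  using family assms by (simp add: operator_family_def L2_eq)

lemma \<E>_mono:
  assumes "t \<le> T" "Q \<in> \<Q> t" "Q' \<in> \<Q> t" "AE \<omega> in P. Q \<omega> \<ge> Q' \<omega>"
  shows "AE \<omega> in P. \<E> t Q \<omega> \<ge> \<E> t Q' \<omega>"
    and "AE \<omega> in P. \<E> t Q \<omega> $ i = \<E> t Q' \<omega> $ i \<Longrightarrow> AE \<omega> in P. Q \<omega> $ i = Q' \<omega> $ i"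
  using consistent assms by (auto simp: consistent_nonlinear_expectation_def)

lemma \<E>_known: "t \<le> T \<Longrightarrow> Q \<in> borel_measurable (\<F> t) \<Longrightarrow> AE \<omega> in P. \<E> t Q \<omega> = Q \<omega>"
  using consistent by (simp add: consistent_nonlinear_expectation_def L2_eq)

lemma \<E>_tower:
  "s \<le> t \<Longrightarrow> t \<le> T \<Longrightarrow> Q \<in> borel_measurable (\<F> T) \<Longrightarrow> AE \<omega> in P. \<E> s (\<E> t Q) \<omega> = \<E> s Q \<omega>"
  using consistent by (simp add: consistent_nonlinear_expectation_def L2_eq)

lemma \<E>_local:
  "t \<le> T \<Longrightarrow> A \<in> sets (\<F> t) \<Longrightarrow> Q \<in> borel_measurable (\<F> T) \<Longrightarrow>
    AE \<omega> in P. indicator A \<omega> *\<^sub>R \<E> t Q \<omega> = \<E> t (\<lambda>\<omega>'. indicator A \<omega>' *\<^sub>R Q \<omega>') \<omega>"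
  using consistent by (simp add: consistent_nonlinear_expectation_def L2_eq)

lemma \<Q>_filt: "t \<le> T \<Longrightarrow> Q \<in> \<Q> t \<Longrightarrow> Q \<in> borel_measurable (\<F> T)"
  using \<Q>_family by (auto simp: L2_subset_family_def L2_eq)

lemma \<Q>_cong:
  "t \<le> T \<Longrightarrow> Q \<in> \<Q> t \<Longrightarrow> Q' \<in> borel_measurable (\<F> T) \<Longrightarrow> AE \<omega> in P. Q \<omega> = Q' \<omega> \<Longrightarrow> Q' \<in> \<Q> t"
  using \<Q>_family by (auto simp: L2_subset_family_def L2_eq)

lemma \<E>_\<Q>: "s \<le> t \<Longrightarrow> t \<le> T \<Longrightarrow> Q \<in> \<Q> s \<Longrightarrow> \<E> t Q \<in> \<Q> s"
  using monotone by (simp add: dynamically_monotone_def)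

lemma matrix_mult_filt_T:
  fixes Z :: "'w \<Rightarrow> real^'n^'k"
  assumes "t < T" "Z \<in> borel_measurable (\<F> t)"
  shows "(\<lambda>\<omega>. Z \<omega> *v M (t + 1) \<omega>) \<in> borel_measurable (\<F> T)"
  using filt_measurable_mono[OF _ _ matrix_mult_filt[OF assms], of T] assms(1) by simp

section \<open>The driver induced by the expectation\<close>

text \<open>A driver takes a deterministic matrix \<open>z\<close>; random ones are substituted
  afterwards. The zero value covers time \<open>T\<close>, where measurability is still demanded but
  nothing is assumed about \<open>X (T + 1)\<close>.\<close>

definition drv :: "('w, 'k, 'n) driver_fun" where
  "drv \<omega> t y z = (if t < T then \<E> t (\<lambda>\<omega>'. z *v M (t + 1) \<omega>') \<omega> else 0)"

text \<open>Locality on the finitely many atoms of \<open>\<F>\<^sub>t\<close> allows a random \<open>Z\<close> to be substituted for \<open>z\<close>,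
  although the exceptional null sets depend on \<open>z\<close>.\<close>
lemma drv_eq:
  assumes t: "t < T" and Z: "Z \<in> borel_measurable (\<F> t)"
  shows "AE \<omega> in P. drv \<omega> t (Y \<omega>) (Z \<omega>) = \<E> t (\<lambda>\<omega>'. Z \<omega>' *v M (t + 1) \<omega>') \<omega>"
proof -
  have tT: "t \<le> T" using t by simp
  obtain k where "AE \<omega> in \<F> t. Z \<omega> = k (hist t \<omega>)"
    using filt_measurable_hist[OF tT Z] ..
  then have k: "AE \<omega> in P. Z \<omega> = k (hist t \<omega>)"
    by (rule AE_filtD[OF tT])
  let ?ZM = "\<lambda>\<omega>. Z \<omega> *v M (t + 1) \<omega>"
  let ?kM = "\<lambda>l \<omega>. k l *v M (t + 1) \<omega>"
  let ?I = "\<lambda>l \<omega>. indicator {\<omega> \<in> space P. hist t \<omega> = l} \<omega> :: real"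
  have ZM: "?ZM \<in> borel_measurable (\<F> T)"
    by (rule matrix_mult_filt_T[OF t Z])
  have kM: "?kM l \<in> borel_measurable (\<F> T)" for l
    by (rule matrix_mult_filt_T[OF t]) simp
  have "AE \<omega> in P. ?I l \<omega> *\<^sub>R \<E> t ?ZM \<omega> = ?I l \<omega> *\<^sub>R \<E> t (?kM l) \<omega>" for l
  proof -
    have I: "?I l \<in> borel_measurable (\<F> T)"
      by (rule filt_measurable_mono[OF tT order_refl])
        (rule borel_measurable_indicator[OF hist_set_filt[OF tT]])
    \<comment> \<open>On the atom with history \<open>l\<close> the random matrix \<open>Z\<close>
      is a.s. the constant \<open>k l\<close>, so both localised arguments agree.\<close>
    have "AE \<omega> in P. \<E> t (\<lambda>\<omega>. ?I l \<omega> *\<^sub>R ?ZM \<omega>) \<omega> = \<E> t (\<lambda>\<omega>. ?I l \<omega> *\<^sub>R ?kM l \<omega>) \<omega>"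
    proof (rule \<E>_cong[OF tT])
      show "AE \<omega> in P. ?I l \<omega> *\<^sub>R ?ZM \<omega> = ?I l \<omega> *\<^sub>R ?kM l \<omega>"
        using k by eventually_elim (auto simp: indicator_def)
    qed (rule borel_measurable_scaleR[OF I ZM] borel_measurable_scaleR[OF I kM])+
    with \<E>_local[OF tT hist_set_filt[OF tT, of l] ZM]
      \<E>_local[OF tT hist_set_filt[OF tT, of l] kM[of l]]
    show ?thesis by eventually_elim simp
  qed
  then have "AE \<omega> in P. \<forall>l\<in>hist t ` space P.
      ?I l \<omega> *\<^sub>R \<E> t ?ZM \<omega> = ?I l \<omega> *\<^sub>R \<E> t (?kM l) \<omega>"
    by (intro AE_finite_allI finite_hists tT)
  then show ?thesis
    using k AE_space
  proof eventually_elim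
    case (elim \<omega>)
    from elim(1)[THEN bspec, OF imageI, OF elim(3)] elim(2,3) t show ?case
      by (simp add: drv_def)
  qed
qed

lemma drv_driver: "driver P X T drv"
proof -
  have zM: "(\<lambda>\<omega>. z *v M (t + 1) \<omega>) \<in> borel_measurable (\<F> T)" if "t < T" for t and z :: "real^'n^'k"
    using that by (intro matrix_mult_filt_T) auto
  have drv: "(\<lambda>\<omega>. drv \<omega> t y z) \<in> borel_measurable (\<F> t)" if "t \<le> T" for t y z
    using \<E>_filt[OF that zM[of t z]] by (cases "t < T") (simp_all add: drv_def)
  \<comment> \<open>\<open>drv\<close> ignores \<open>y\<close>, so its argument can be fixed to
    zero and only \<open>Z\<close> is a random parameter.\<close>
  have "(\<lambda>\<omega>. drv \<omega> t (Y \<omega>) (Z \<omega>)) \<in> borel_measurable (\<F> t)"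
    if "t \<le> T" "Z \<in> borel_measurable (\<F> t)" for t and Y :: "'w \<Rightarrow> real^'k" and Z
    using filt_random_parameter[OF that(1) drv[OF that(1), of 0] that(2)]
    by (simp add: drv_def[abs_def])
  with drv show ?thesis by (auto simp: driver_def Linf_eq)
qed

lemma drv_independent: "independent_of_Y P X T drv"
  by (auto simp: independent_of_Y_def drv_def)

lemma drv_normalised: "normalised_driver P X T drv"
  unfolding normalised_driver_def
proof (intro allI impI ballI)
  fix t Y assume t: "t < T"
  then have "AE \<omega> in P. \<E> t (\<lambda>_. 0) \<omega> = 0"
    by (intro \<E>_known) auto
  then show "AE \<omega> in P. drv \<omega> t (Y \<omega>) 0 = 0"
    using t by (simp add: drv_def)
qed

text \<open>\<open>\<E>\<close> respects a.s. equality, which gives invariance under equivalent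
  \<open>Z\<close>. As \<open>drv\<close> ignores \<open>y\<close>, subtracting the driver from
  \<open>y\<close> is a translation, hence a bijection.\<close>

lemma drv_regular: "regular_driver P X T drv"
  unfolding regular_driver_def
proof (intro conjI allI impI ballI)
  show "driver P X T drv" by (rule drv_driver)
next
  fix Y :: "nat \<Rightarrow> 'w \<Rightarrow> real^'k" and Z1 Z2 :: "nat \<Rightarrow> 'w \<Rightarrow> real^'n^'k" and t
  assume Z: "adapted P X T Z1" "adapted P X T Z2" "sim_process P X T Z1 Z2" and t: "t < T"
  then have Z': "Z1 t \<in> borel_measurable (\<F> t)" "Z2 t \<in> borel_measurable (\<F> t)"
    by (auto intro: adapted_filt)
  have "AE \<omega> in P. Z1 t \<omega> *v M (t + 1) \<omega> = Z2 t \<omega> *v M (t + 1) \<omega>"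
    using Z(3) t by (simp add: sim_process_def sim_at_def)
  then have "AE \<omega> in P. \<E> t (\<lambda>\<omega>'. Z1 t \<omega>' *v M (t + 1) \<omega>') \<omega> = \<E> t (\<lambda>\<omega>'. Z2 t \<omega>' *v M (t + 1) \<omega>') \<omega>"
    using t by (intro \<E>_cong matrix_mult_filt_T Z') auto
  with drv_eq[OF t Z'(1), of "Y t"] drv_eq[OF t Z'(2), of "Y t"]
  show "AE \<omega> in P. drv \<omega> t (Y t \<omega>) (Z1 t \<omega>) = drv \<omega> t (Y t \<omega>) (Z2 t \<omega>)"
    by eventually_elim simp
next
  fix Z :: "nat \<Rightarrow> 'w \<Rightarrow> real^'n^'k" and t and W :: "'w \<Rightarrow> real^'k"
  assume "adapted P X T Z" "t < T" and W: "W \<in> borel_measurable (\<F> t)"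
  then have "(\<lambda>\<omega>. drv \<omega> t 0 (Z t \<omega>)) \<in> borel_measurable (\<F> t)"
    using driver_filt[OF drv_driver, of t "\<lambda>_. 0" "Z t"] adapted_filt[of Z t] by auto
  with W have "(\<lambda>\<omega>. W \<omega> + drv \<omega> t 0 (Z t \<omega>)) \<in> borel_measurable (\<F> t)"
    by (rule borel_measurable_add)
  then show "\<exists>Y\<in>borel_measurable (\<F> t). AE \<omega> in P. Y \<omega> - drv \<omega> t (Y \<omega>) (Z t \<omega>) = W \<omega>"
    by (rule bexI[rotated]) (simp add: drv_def)
next
  fix Z :: "nat \<Rightarrow> 'w \<Rightarrow> real^'n^'k" and t and Y Y' :: "'w \<Rightarrow> real^'k"
  assume "AE \<omega> in P. Y \<omega> - drv \<omega> t (Y \<omega>) (Z t \<omega>) = Y' \<omega> - drv \<omega> t (Y' \<omega>) (Z t \<omega>)"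
  then show "AE \<omega> in P. Y \<omega> = Y' \<omega>"
    by (simp add: drv_def)
qed

section \<open>Representation of the expectation by its BSDE\<close>

lemma drv_solution:
  assumes ti: "translation_invariant P X T \<E>" and Q: "Q \<in> borel_measurable (\<F> T)"
  shows "\<exists>Z. bsde_solution P X T drv Q (\<lambda>t. \<E> t Q) Z"
proof -
  \<comment> \<open>One step of the BSDE as a predicate in \<open>Z\<close>, so that the matrices
    for all times can be chosen at once.\<close>
  define R where "R t Z \<longleftrightarrow> Z \<in> borel_measurable (\<F> t) \<and>
      (AE \<omega> in P. \<E> (t + 1) Q \<omega> = \<E> t Q \<omega> - drv \<omega> t (\<E> t Q \<omega>) (Z \<omega>) + Z \<omega> *v M (t + 1) \<omega>)" for t and Z :: "'w \<Rightarrow> real^'n^'k"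
  have "\<exists>Z. R t Z" if t: "t < T" for t
  proof -
    have tT: "t \<le> T" "t + 1 \<le> T" using t by auto
    have W: "\<E> (t + 1) Q \<in> borel_measurable (\<F> (t + 1))"
      by (rule \<E>_filt[OF tT(2) Q])
    obtain Z where Z: "Z \<in> borel_measurable (\<F> t)"
      and WZ: "AE \<omega> in P. \<E> (t + 1) Q \<omega> = Z \<omega> *v X (t + 1) \<omega>"
      using next_step_representation[OF t W] ..
    \<comment> \<open>\<open>c\<close> is the part of \<open>Z\<close> applied to
      \<open>X (t + 1)\<close> that is known at time \<open>t\<close>; translation invariance takes
      it out of \<open>\<E> t\<close>.\<close>
    define c where "c \<omega> = Z \<omega> *v cond_mean P X t (X (t + 1)) \<omega>" for \<omega>
    have c: "c \<in> borel_measurable (\<F> t)"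
      unfolding c_def[abs_def] by (rule filt_combine[OF tT(1) Z cond_mean_filt])
    have ZM: "(\<lambda>\<omega>. Z \<omega> *v M (t + 1) \<omega>) \<in> borel_measurable (\<F> T)"
      by (rule matrix_mult_filt_T[OF t Z])
    have eq: "AE \<omega> in P. \<E> (t + 1) Q \<omega> = Z \<omega> *v M (t + 1) \<omega> + c \<omega>"
      using WZ by eventually_elim (simp add: c_def mart_diff_def matrix_vector_mult_diff_distrib)
    have "AE \<omega> in P. \<E> t (\<E> (t + 1) Q) \<omega> = \<E> t (\<lambda>\<omega>'. Z \<omega>' *v M (t + 1) \<omega>' + c \<omega>') \<omega>"
      by (rule \<E>_cong[OF tT(1) filt_measurable_mono[OF tT(2) order_refl W] _ eq])
        (rule borel_measurable_add[OF ZM filt_measurable_mono[OF tT(1) order_refl c]])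
    moreover have "AE \<omega> in P. \<E> t (\<lambda>\<omega>'. Z \<omega>' *v M (t + 1) \<omega>' + c \<omega>') \<omega>
        = \<E> t (\<lambda>\<omega>'. Z \<omega>' *v M (t + 1) \<omega>') \<omega> + c \<omega>"
      using ti tT ZM c by (simp add: translation_invariant_def L2_eq)
    moreover have "AE \<omega> in P. \<E> t (\<E> (t + 1) Q) \<omega> = \<E> t Q \<omega>"
      by (rule \<E>_tower[OF _ tT(2) Q]) simp
    ultimately have "AE \<omega> in P. \<E> (t + 1) Q \<omega> =
        \<E> t Q \<omega> - drv \<omega> t (\<E> t Q \<omega>) (Z \<omega>) + Z \<omega> *v M (t + 1) \<omega>"
      using eq drv_eq[OF t Z, of "\<E> t Q"]
    proof eventually_elim
      case (elim \<omega>)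
      from elim(1-3) have "\<E> t Q \<omega> = \<E> t (\<lambda>\<omega>'. Z \<omega>' *v M (t + 1) \<omega>') \<omega> + c \<omega>"
        by (simp only:)
      with elim(4,5) show ?case by simp
    qed
    with Z have "R t Z" by (simp add: R_def)
    then show ?thesis by (intro exI[of _ Z])
  qed
  then obtain Z where Z: "\<And>t. t < T \<Longrightarrow> R t (Z t)"
    by metis
  \<comment> \<open>The equation involves \<open>Z\<close> only before \<open>T\<close>; the value
    zero from \<open>T\<close> on makes the process adapted.\<close>
  have "bsde_solution P X T drv Q (\<lambda>t. \<E> t Q) (\<lambda>t. if t < T then Z t else (\<lambda>_. 0))"
    unfolding bsde_solution_iff
    using Z Q by (simp add: R_def adapted_def Linf_eq \<E>_filt \<E>_known)
  then show ?thesis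
    by (intro exI[of _ "\<lambda>t. if t < T then Z t else (\<lambda>_. 0)"])
qed

text \<open>Uniqueness is the shift by zero. Balancedness concerns arbitrary solutions, which are
  hereby identified with \<open>\<E>\<close>.\<close>

lemma drv_solution_unique:
  assumes ti: "translation_invariant P X T \<E>" and Q: "Q \<in> borel_measurable (\<F> T)"
    and sol: "bsde_solution P X T drv Q Y Z" and t: "t \<le> T"
  shows "AE \<omega> in P. Y t \<omega> = \<E> t Q \<omega>"
proof -
  obtain Z' where "bsde_solution P X T drv Q (\<lambda>t. \<E> t Q) Z'"
    using drv_solution[OF ti Q] ..
  from bsde_shift[OF drv_regular drv_independent this sol t, of "\<lambda>_. 0" t] t
  show ?thesis by simp
qed

section \<open>Comparison and balancedness\<close>

text \<open>\<open>\<E> (t + 1) Q\<close> stays in \<open>\<Q> t\<close> by dynamic monotonicity,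
  and it differs from the increment only by an \<open>\<F> t\<close>-measurable shift, under which
  \<open>\<Q> t\<close> is closed. This admits the increments to strict monotonicity.\<close>

lemma solution_increment_\<Q>:
  assumes ti: "translation_invariant P X T \<E>" and t: "t < T" and Q: "Q \<in> \<Q> t"
    and sol: "bsde_solution P X T drv Q Y Z"
  shows "(\<lambda>\<omega>. Z t \<omega> *v M (t + 1) \<omega>) \<in> \<Q> t"
proof -
  have tT: "t \<le> T" "t + 1 \<le> T" using t by auto
  have meas: "Y t \<in> borel_measurable (\<F> t)" "Z t \<in> borel_measurable (\<F> t)"
    using sol tT by (auto simp: bsde_solution_iff intro: adapted_filt)
  \<comment> \<open>By the one-step equation, adding this \<open>q\<close> to
    \<open>Y (t + 1)\<close> leaves exactly \<open>Z t\<close> applied to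
    \<open>M (t + 1)\<close>.\<close>
  define q where "q \<omega> = drv \<omega> t (Y t \<omega>) (Z t \<omega>) - Y t \<omega>" for \<omega>
  have "q \<in> borel_measurable (\<F> t)"
    unfolding q_def[abs_def]
    by (rule borel_measurable_diff[OF driver_filt[OF drv_driver tT(1) meas] meas(1)])
  then have "(\<lambda>\<omega>. \<E> (t + 1) Q \<omega> + q \<omega>) \<in> \<Q> t"
    using \<E>_\<Q>[OF _ tT(2) Q] tT by (intro \<Q>_add) (auto simp: Linf_eq)
  then show ?thesis
  proof (rule \<Q>_cong[OF tT(1)])
    have "AE \<omega> in P. Y (t + 1) \<omega> = \<E> (t + 1) Q \<omega>"
      by (rule drv_solution_unique[OF ti \<Q>_filt[OF tT(1) Q] sol tT(2)])
    moreover have "AE \<omega> in P. Y (t + 1) \<omega> = Y t \<omega> - drv \<omega> t (Y t \<omega>) (Z t \<omega>) + Z t \<omega> *v M (t + 1) \<omega>"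
      using sol t by (simp add: bsde_solution_iff)
    ultimately show "AE \<omega> in P. \<E> (t + 1) Q \<omega> + q \<omega> = Z t \<omega> *v M (t + 1) \<omega>"
    proof eventually_elim
      case (elim \<omega>)
      show ?case unfolding elim(1)[symmetric] elim(2) q_def by simp
    qed
  qed (rule matrix_mult_filt_T[OF t meas(2)])
qed

text \<open>The inequality is monotonicity combined with translation by the minimum
  \<open>c\<close>. In the equality case strictness makes row \<open>i\<close> an equation, so
  \<open>c $ i\<close> is an \<open>\<F> t\<close>-measurable martingale increment; hence it is zero
  and the rows are equivalent.\<close>

lemma drv_comparison:
  fixes Z1 Z2 :: "'w \<Rightarrow> real^'n^'k" and Y :: "'w \<Rightarrow> real^'k"
  assumes ti: "translation_invariant P X T \<E>" and t: "t < T"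
    and Z: "Z1 \<in> borel_measurable (\<F> t)" "Z2 \<in> borel_measurable (\<F> t)"
    and ZM: "(\<lambda>\<omega>. Z1 \<omega> *v M (t + 1) \<omega>) \<in> \<Q> t" "(\<lambda>\<omega>. Z2 \<omega> *v M (t + 1) \<omega>) \<in> \<Q> t"
  defines "lhs \<equiv> \<lambda>i \<omega>. drv \<omega> t (Y \<omega>) (Z1 \<omega>) $ i - drv \<omega> t (Y \<omega>) (Z2 \<omega>) $ i"
    and "rhs \<equiv> \<lambda>i \<omega>. Min ((\<lambda>j. ((Z1 \<omega> - Z2 \<omega>) *v
                (axis j 1 - cond_mean P X t (X (t + 1)) \<omega>)) $ i) ` possible_jumps P X t \<omega>)"
  shows "AE \<omega> in P. \<forall>i. lhs i \<omega> \<ge> rhs i \<omega>"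
    and "AE \<omega> in P. lhs i \<omega> = rhs i \<omega> \<Longrightarrow> sim_row_at P X t (\<lambda>\<omega>. Z1 \<omega> $ i) (\<lambda>\<omega>. Z2 \<omega> $ i)"
proof -
  have tT: "t \<le> T" using t by simp
  let ?m = "cond_mean P X t (X (t + 1))"
  \<comment> \<open>The vector of conditional jump probabilities. It expresses
    \<open>possible_jumps\<close> through an \<open>\<F> t\<close>-measurable variable, whence
    \<open>c\<close> is measurable.\<close>
  let ?p = "cond_mean P X t (\<lambda>\<omega>. \<chi> j. indicator {\<omega> \<in> space P. X (t + 1) \<omega> = axis j 1} \<omega>)"
  let ?Z1 = "\<lambda>\<omega>. Z1 \<omega> *v M (t + 1) \<omega>" and ?Z2 = "\<lambda>\<omega>. Z2 \<omega> *v M (t + 1) \<omega>"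
  define c :: "'w \<Rightarrow> real^'k" where "c \<omega> = (\<chi> i. rhs i \<omega>)" for \<omega>
  have jumps: "possible_jumps P X t \<omega> = {j. ?p \<omega> $ j > 0}" for \<omega>
    by (simp add: possible_jumps_def cond_mean_def)
  have "(\<lambda>\<omega>. (?m \<omega>, ?p \<omega>)) \<in> borel_measurable (\<F> t)"
    by (intro borel_measurable_Pair cond_mean_filt)
  from filt_combine[OF tT borel_measurable_diff[OF Z] this,
      of "\<lambda>d (m, p). \<chi> i. Min ((\<lambda>j. (d *v (axis j 1 - m)) $ i) ` {j. p $ j > 0})"]
  have c: "c \<in> borel_measurable (\<F> t)"
    unfolding c_def[abs_def] rhs_def jumps by simp
  have "AE \<omega> in P. ?Z1 \<omega> \<ge> ?Z2 \<omega> + c \<omega>"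
    using jump_possible[OF t] AE_space
  proof eventually_elim
    case (elim \<omega>)
    obtain j where j: "X (t + 1) \<omega> = axis j 1"
      using X_basis[of "t + 1" \<omega>] elim(2) t by auto
    with elim(1) have J: "j \<in> possible_jumps P X t \<omega>" by simp
    \<comment> \<open>The jump that occurs is a possible one, so its value is among those over which
      the minimum is taken.\<close>
    have "c \<omega> $ i \<le> ((Z1 \<omega> - Z2 \<omega>) *v M (t + 1) \<omega>) $ i" for i
      unfolding c_def rhs_def vec_lambda_beta
      by (rule Min_le) (use J j in \<open>auto simp: mart_diff_def\<close>)
    then show ?case
      by (simp add: less_eq_vec_def algebra_simps)
  qed
  moreover have Z2c: "(\<lambda>\<omega>. ?Z2 \<omega> + c \<omega>) \<in> \<Q> t"
    using c tT ZM(2) by (intro \<Q>_add) (auto simp: Linf_eq)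
  ultimately have mono:
    "AE \<omega> in P. \<E> t ?Z1 \<omega> \<ge> \<E> t (\<lambda>\<omega>. ?Z2 \<omega> + c \<omega>) \<omega>"
    "AE \<omega> in P. \<E> t ?Z1 \<omega> $ i = \<E> t (\<lambda>\<omega>. ?Z2 \<omega> + c \<omega>) \<omega> $ i \<Longrightarrow>
      AE \<omega> in P. ?Z1 \<omega> $ i = (?Z2 \<omega> + c \<omega>) $ i" for i
    using \<E>_mono[OF tT ZM(1) Z2c] by blast+
  have shift: "AE \<omega> in P. \<E> t (\<lambda>\<omega>. ?Z2 \<omega> + c \<omega>) \<omega> = \<E> t ?Z2 \<omega> + c \<omega>"
    using ti tT c \<Q>_filt[OF tT ZM(2)] by (simp add: translation_invariant_def L2_eq)
  show "AE \<omega> in P. \<forall>i. lhs i \<omega> \<ge> rhs i \<omega>"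
    using mono(1) shift drv_eq[OF t Z(1), of Y] drv_eq[OF t Z(2), of Y]
    by eventually_elim (simp add: lhs_def less_eq_vec_def c_def le_diff_eq add.commute)
  show "sim_row_at P X t (\<lambda>\<omega>. Z1 \<omega> $ i) (\<lambda>\<omega>. Z2 \<omega> $ i)" if "AE \<omega> in P. lhs i \<omega> = rhs i \<omega>"
  proof -
    have "AE \<omega> in P. \<E> t ?Z1 \<omega> $ i = \<E> t (\<lambda>\<omega>. ?Z2 \<omega> + c \<omega>) \<omega> $ i"
      using that shift drv_eq[OF t Z(1), of Y] drv_eq[OF t Z(2), of Y]
      by eventually_elim (simp add: lhs_def c_def diff_eq_eq add.commute)
    from mono(2)[OF this]
    have eq: "AE \<omega> in P. (Z1 \<omega> $ i - Z2 \<omega> $ i) \<bullet> M (t + 1) \<omega> = c \<omega> $ i"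
      by eventually_elim (simp add: matrix_vector_mul_component inner_diff_left)
    have "AE \<omega> in P. c \<omega> $ i = 0"
      using filt_compose[OF tT borel_measurable_diff[OF Z], of "\<lambda>d. d $ i"]
        filt_compose[OF tT c, of "\<lambda>d. d $ i"]
      by (intro mart_diff_centred[OF t _ _ eq]) auto
    with eq show ?thesis
      unfolding sim_row_at_def by eventually_elim (simp add: inner_diff_left)
  qed
qed

lemma drv_balanced:
  assumes ti: "translation_invariant P X T \<E>"
  shows "balanced_driver P X T \<Q> drv"
proof -
  {
    fix t Q1 Q2 Y1 Z1 Y2 Z2
    assume t: "t < T" and Q: "Q1 \<in> \<Q> t" "Q2 \<in> \<Q> t"
      and sol: "bsde_solution P X T drv Q1 Y1 Z1" "bsde_solution P X T drv Q2 Y2 Z2"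
    have "Z1 t \<in> borel_measurable (\<F> t)" "Z2 t \<in> borel_measurable (\<F> t)"
      using sol t by (auto simp: bsde_solution_iff intro: adapted_filt)
    note drv_comparison[OF ti t this solution_increment_\<Q>[OF ti t Q(1) sol(1)]
        solution_increment_\<Q>[OF ti t Q(2) sol(2)], of "Y2 t"]
  }
  note comparison = this
  \<comment> \<open>In the last condition of balancedness the two driver terms coincide because
    \<open>drv\<close> ignores \<open>y\<close>, so they cancel and the order of \<open>Y1\<close>
    and \<open>Y2\<close> is immediate.\<close>
  show ?thesis
    unfolding balanced_driver_def Let_def
    by (intro conjI allI impI ballI drv_regular comparison) (assumption | simp add: drv_def)+
qed

lemma drv_represents: "translation_invariant P X T \<E> \<Longrightarrow> represents P X T \<Q> \<E> drv"
  using drv_balanced drv_independent drv_normalised drv_solution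
  by (simp add: represents_def L2_eq)

section \<open>From a representing driver back to the expectation\<close>

text \<open>The values of \<open>\<E>\<close> at \<open>Q\<close> and at \<open>Q + q\<close> are
  first components of solutions whose terminal values differ by \<open>q\<close>, so the shift
  property of solutions compares them.\<close>

lemma represents_translation_invariant:
  assumes "represents P X T \<Q> \<E> F"
  shows "translation_invariant P X T \<E>"
  unfolding translation_invariant_def
proof (intro allI impI ballI)
  fix t and Q q :: "'w \<Rightarrow> real^'k"
  assume t: "t \<le> T" and Q: "Q \<in> L2 P X T" and "q \<in> L2 P X t"
  then have q: "q \<in> borel_measurable (\<F> t)" by (simp add: L2_eq)
  have "(\<lambda>\<omega>. Q \<omega> + q \<omega>) \<in> L2 P X T"
    using Q filt_measurable_mono[OF t order_refl q] by (simp add: L2_eq)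
  with assms Q obtain Z Z' where "bsde_solution P X T F Q (\<lambda>t. \<E> t Q) Z"
    "bsde_solution P X T F (\<lambda>\<omega>. Q \<omega> + q \<omega>) (\<lambda>t. \<E> t (\<lambda>\<omega>. Q \<omega> + q \<omega>)) Z'"
    unfolding represents_def by blast
  from bsde_shift[OF _ _ this t q, of t] assms t
  show "AE \<omega> in P. \<E> t (\<lambda>\<omega>'. Q \<omega>' + q \<omega>') \<omega> = \<E> t Q \<omega> + q \<omega>"
    by (simp add: represents_def balanced_driver_def)
qed

text \<open>With \<open>Z\<close> applied to \<open>M (t + 1)\<close> as terminal value
  \<open>Q\<close>, the step from \<open>t\<close> to \<open>t + 1\<close> is solved both by
  \<open>\<E> t Q\<close> and by \<open>y = F(Y, Z)\<close>, since independence of \<open>Y\<close>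
  gives \<open>y - F(y, Z) = 0\<close>. One-step uniqueness with \<open>q = 0\<close> equates
  them.\<close>

lemma represents_driver_eq:
  assumes F: "represents P X T \<Q> \<E> F" and t: "t < T"
    and Y: "Y \<in> borel_measurable (\<F> t)" and Z: "Z \<in> borel_measurable (\<F> t)"
  shows "AE \<omega> in P. F \<omega> t (Y \<omega>) (Z \<omega>) = \<E> t (\<lambda>\<omega>'. Z \<omega>' *v M (t + 1) \<omega>') \<omega>"
proof -
  have tT: "t \<le> T" "t + 1 \<le> T" using t by auto
  have reg: "regular_driver P X T F" and ind: "independent_of_Y P X T F"
    using F by (auto simp: represents_def balanced_driver_def)
  then have "driver P X T F" by (simp add: regular_driver_def)
  define Q where "Q \<omega> = Z \<omega> *v M (t + 1) \<omega>" for \<omega>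
  define y where "y \<omega> = F \<omega> t (Y \<omega>) (Z \<omega>)" for \<omega>
  have y: "y \<in> borel_measurable (\<F> t)"
    unfolding y_def[abs_def] by (rule driver_filt[OF \<open>driver P X T F\<close> tT(1) Y Z])
  have Q: "Q \<in> borel_measurable (\<F> (t + 1))" "Q \<in> borel_measurable (\<F> T)"
    unfolding Q_def[abs_def] by (rule matrix_mult_filt[OF t Z] matrix_mult_filt_T[OF t Z])+
  obtain Z' where sol: "bsde_solution P X T F Q (\<lambda>t. \<E> t Q) Z'"
    using F Q by (auto simp: represents_def L2_eq)
  have meas: "\<E> t Q \<in> borel_measurable (\<F> t)" "Z' t \<in> borel_measurable (\<F> t)"
    using sol tT by (auto simp: bsde_solution_iff intro: adapted_filt)
  have "AE \<omega> in P. \<E> (t + 1) Q \<omega> = \<E> t Q \<omega> - F \<omega> t (\<E> t Q \<omega>) (Z' t \<omega>) + Z' t \<omega> *v M (t + 1) \<omega>"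
    using sol t by (simp add: bsde_solution_iff)
  moreover have "AE \<omega> in P. \<E> (t + 1) Q \<omega> = Q \<omega>"
    by (rule \<E>_known[OF tT(2) Q(1)])
  moreover have "AE \<omega> in P. F \<omega> t (Y \<omega>) (Z \<omega>) = F \<omega> t (y \<omega>) (Z \<omega>)"
    using ind t Y Z y by (simp add: independent_of_Y_def Linf_eq)
  ultimately have eq: "AE \<omega> in P. \<E> t Q \<omega> - F \<omega> t (\<E> t Q \<omega>) (Z' t \<omega>) + Z' t \<omega> *v M (t + 1) \<omega> =
      y \<omega> - F \<omega> t (y \<omega>) (Z \<omega>) + Z \<omega> *v M (t + 1) \<omega> + 0"
  proof eventually_elim
    case (elim \<omega>)
    show ?case unfolding elim(1)[symmetric] elim(2) elim(3)[symmetric] by (simp add: Q_def y_def)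
  qed
  have "AE \<omega> in P. \<E> t Q \<omega> = y \<omega> + 0"
    by (rule bsde_step_unique[OF reg ind t y meas(1) Z meas(2) _ eq]) simp
  then show ?thesis
    by eventually_elim (simp add: y_def Q_def[abs_def])
qed

end

theorem theorem6p1:
  fixes P :: "'w measure"
    and X :: "nat \<Rightarrow> 'w \<Rightarrow> real^'n"
    and T :: nat
    and \<E> :: "nat \<Rightarrow> ('w \<Rightarrow> real^'k) \<Rightarrow> ('w \<Rightarrow> real^'k)"
    and \<Q> :: "nat \<Rightarrow> ('w \<Rightarrow> real^'k) set"
  assumes "prob_space P"
    and "T \<ge> 1"
    and "\<And>t. t \<le> T \<Longrightarrow> X t \<in> borel_measurable P"
    and "\<And>t \<omega>. t \<le> T \<Longrightarrow> \<omega> \<in> space P \<Longrightarrow> X t \<omega> \<in> range (\<lambda>j. axis j 1)"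
    and "operator_family P X T \<E>"
    and "L2_subset_family P X T \<Q>"
    and "\<And>t Q q. t \<le> T \<Longrightarrow> Q \<in> \<Q> t \<Longrightarrow> q \<in> Linf P X t \<Longrightarrow> (\<lambda>\<omega>. Q \<omega> + q \<omega>) \<in> \<Q> t"
    and "dynamically_monotone P X T \<Q> \<E>"
  shows "(consistent_nonlinear_expectation P X T \<Q> \<E> \<and> translation_invariant P X T \<E>
            \<longleftrightarrow> (\<exists>F. represents P X T \<Q> \<E> F)) \<and>
         (\<forall>F. represents P X T \<Q> \<E> F \<longrightarrow>
            (\<forall>t<T. \<forall>Y\<in>Linf P X t. \<forall>Z\<in>Linf P X t.
               AE \<omega> in P. F \<omega> t (Y \<omega>) (Z \<omega>) = \<E> t (\<lambda>\<omega>'. Z \<omega>' *v mart_diff P X (t + 1) \<omega>') \<omega>))"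
proof -
  interpret monotone_expectation P X T \<E> \<Q>
    using assms by (simp add: monotone_expectation_def monotone_expectation_axioms_def
        basis_process_def basis_process_axioms_def)
  show ?thesis
  proof (intro conjI iffI allI impI ballI)
    assume "consistent_nonlinear_expectation P X T \<Q> \<E> \<and> translation_invariant P X T \<E>"
    then show "\<exists>F. represents P X T \<Q> \<E> F"
      using drv_represents by (intro exI[of _ drv]) simp
  next
    assume "\<exists>F. represents P X T \<Q> \<E> F"
    then show "translation_invariant P X T \<E>"
      using represents_translation_invariant by (elim exE)
  next
    fix F :: "('w, 'k, 'n) driver_fun" and t and Y :: "'w \<Rightarrow> real^'k" and Z :: "'w \<Rightarrow> real^'n^'k"
    assume "represents P X T \<Q> \<E> F" "t < T" "Y \<in> Linf P X t" "Z \<in> Linf P X t"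
    then show "AE \<omega> in P. F \<omega> t (Y \<omega>) (Z \<omega>) = \<E> t (\<lambda>\<omega>'. Z \<omega>' *v M (t + 1) \<omega>') \<omega>"
      by (intro represents_driver_eq) (simp_all add: Linf_eq)
  qed (rule consistent)
qed

end
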